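(* Let $\beta\in\mathbb R$ and let $\ell$ be any non-trivial loop in $\mathbb Z^2$. Then $\phi^K(\ell)=0$ for every finite plaquette assignment $K\notin\mathcal K_\ell$, where $\mathcal K_\ell$ is the canonical collection of plaquette assignments associated with $\ell$. Consequently $$\phi(\ell)=\sum_{K\in\mathcal K_\ell} c(\ell,K)\,\beta^{\operatorname{area}(K)},$$ where the coefficients $c(\ell,K)$ do not depend on $\beta$, and $\operatorname{area}(K)=\sum_{p\in\mathcal P}K(p)$.
   Context: **Lattice and loops.** $E$ is the set of oriented nearest-neighbour edges of $\mathbb Z^2$; $e^{-1}$ is $e$ reversed. A loop is a closed walk $\ell=e_1e_2\cdots e_n$ of oriented edges, considered up to cyclic rotation; the null-loop $\emptyset$ has no edges. A loop has a backtrack if (cyclically) it is of the form $\pi_1\,e\,e^{-1}\,\pi_2$; removing the backtrack gives $\pi_1\pi_2$. Backtracks are not removed unless explicitly stated. A loop is trivial if removing all its backtracks gives $\emptyset$. A plaquette is an oriented loop of four edges around a unit square; $\mathcal P$ is the set of all plaquettes, $p^{-1}$ is $p$ with reversed orientation, and $\mathcal P^+$ is the set of positively oriented ones (leftmost edge oriented upwards). $\mathcal P(e)$ is the set of plaquettes containing the oriented edge $e$. Two plaquettes are adjacent if they share exactly one unoriented edge, denoted $\mathfrak e(p,q)$. **Plaquette assignments.** A plaquette assignment is a map $K:\mathcal P\to\mathbb Z_{\ge0}$; it is finite if $\operatorname{area}(K)=\sum_p K(p)<\infty$. If $K(p)\ge1$, $K\setminus p$ is $K$ with its value at $p$ decreased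 by $1$. Let $n_e(\ell)$ be the number of copies of $e$ in $\ell$ and $n_e(\ell,K)=n_e(\ell)+\sum_{p\in\mathcal P(e)}K(p)$. The pair $(\ell,K)$ is balanced if $n_e(\ell,K)=n_{e^{-1}}(\ell,K)$ for all $e\in E$. **Loop operations** at a specific copy $\mathbf e$ of an edge $e$ in $\ell$. Positive splittings: for each other copy $\mathbf e'$ of $e$ in $\ell$, writing $\ell=\pi_1\mathbf e\pi_2\mathbf e'\pi_3$, the pair of loops $\{\pi_1\mathbf e\pi_3,\ \pi_2\mathbf e'\}$; the multiset of these is $\mathbb S_+(\mathbf e,\ell)$. Negative splittings: for each copy $\mathbf e^{-1}$ of $e^{-1}$ in $\ell$, writing $\ell=\pi_1\mathbf e\pi_2\mathbf e^{-1}\pi_3$, the pair $\{\pi_1\pi_3,\ \pi_2\}$; the multiset of these is $\mathbb S_-(\mathbf e,\ell)$. Deformations: with $\ell=\mathbf e\pi_1$, for $q=\mathbf e'\pi_2\in\mathcal P(e)$ ($\mathbf e'$ a copy of $e$) set $\ell\oplus_{\mathbf e}q=\mathbf e\pi_2\mathbf e'\pi_1$; for $p=\mathbf e^{-1}\pi_2\in\mathcal P(e^{-1})$ set $\ell\ominus_{\mathbf e}p=\pi_2\pi_1$. **Coefficients and surface sums.** The real coefficients $c(\ell,K)$ ($\ell$ a loop, $K$ a finite plaquette assignment) of the large-$N$ lattice Yang–Mills surface sum are the unique ones such that: (1) $c(\ell,K)=0$ if $(\ell,K)$ is not balanced; (2) $c(\ell,0)=0$ for non-trivial $\ell$, $c(\emptyset,0)=1$,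 and $c(\emptyset,K)=0$ for $K\neq0$; (3) (master loop equation) for every non-null loop $\ell$, every finite $K$ and every choice of a copy $\mathbf e$ of an edge $e$ in $\ell$, $$c(\ell,K)=\sum_{\{\ell_1,\ell_2\}\in\mathbb S_-(\mathbf e,\ell)}\ \sum_{K_1+K_2=K}c(\ell_1,K_1)c(\ell_2,K_2)-\sum_{\{\ell_1,\ell_2\}\in\mathbb S_+(\mathbf e,\ell)}\ \sum_{K_1+K_2=K}c(\ell_1,K_1)c(\ell_2,K_2)+\sum_{p\in\mathcal P(e^{-1}),K(p)\ge1}c(\ell\ominus_{\mathbf e}p,K\setminus p)-\sum_{q\in\mathcal P(e),K(q)\ge1}c(\ell\oplus_{\mathbf e}q,K\setminus q).$$ It is known that such coefficients exist and that $c(\pi_1ee^{-1}\pi_2,K)=c(\pi_1\pi_2,K)$ for balanced pairs. For $\beta\in\mathbb R$, $\phi^K(\ell)=c(\ell,K)\beta^{\operatorname{area}(K)}$ (with $\beta^0=1$) and $\phi(\ell)=\sum_K\phi^K(\ell)$, the sum being over all finite plaquette assignments. **Height.** $h_\ell:\mathcal P\to\mathbb Z$ is the unique function with $h_\ell(p^{-1})=h_\ell(p)$, $h_\ell(p)=0$ for plaquettes outside a large box containing $\ell$, and, for adjacent $p,q\in\mathcal P^+$, $h_\ell(q)=h_\ell(p)+n-m$, where $n$ (resp. $m$) is the number of times $\ell$ crosses the oriented segment from the center of $p$ to the center of $q$ from right to left (resp. left to right). **Distance.** A path of plaquettes is a sequence $\{p_i\}$ of distinct positively oriented plaquettes with $p_i,p_{i+1}$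 adjacent. For an unoriented edge $\mathfrak e$ let $n_{\mathfrak e}(\ell)$ be the number of copies of $\mathfrak e$ in $\ell$ in either orientation. For $p\in\mathcal P^+$, $d_\ell(p)=\min\sum_{i\ge1}n_{\mathfrak e(p_i,p_{i+1})}(\ell)$ over infinite paths of plaquettes with $p_1=p$; and $d_\ell(p^{-1})=d_\ell(p)$. **Plaquette-regions of $\ell$**: the collections of plaquettes (both orientations of each) whose unit squares lie in the same connected component of the complement of $\ell$ in the plane. **Height plaquette assignment** $K_\ell$: for $p\in\mathcal P^+$, $(K_\ell(p),K_\ell(p^{-1}))=(0,|h_\ell(p)|)$ if $h_\ell(p)\ge0$ and $(|h_\ell(p)|,0)$ if $h_\ell(p)<0$. **Canonical collection** $\mathcal K_\ell$: if $\ell$ has no backtracks, $\mathcal K_\ell$ is the set of finite plaquette assignments $K=K_\ell+K'$ with (1) $K'(p)=K'(p^{-1})$ for all $p\in\mathcal P$; (2) $K'(p)=K'(q)$ for all $p,q\in\mathcal P^+$ in the same plaquette-region of $\ell$; (3) $K'(p)\le\frac{d_\ell(p)-|h_\ell(p)|}{2}$ for all $p\in\mathcal P^+$. If $\ell$ has backtracks, $\mathcal K_\ell:=\mathcal K_{\ell'}$ where $\ell'$ is $\ell$ with all backtracks removed. *)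

theory Defs
  imports "HOL-Analysis.Analysis"
begin

type_synonym vertex = "int \<times> int"
type_synonym edge = "vertex \<times> vertex"

definition lattice_edge :: "edge \<Rightarrow> bool" where
  "lattice_edge e \<longleftrightarrow>
     \<bar>fst (snd e) - fst (fst e)\<bar> + \<bar>snd (snd e) - snd (fst e)\<bar> = 1"

abbreviation inv_edge :: "edge \<Rightarrow> edge" where
  "inv_edge e \<equiv> prod.swap e"

definition uedge :: "edge \<Rightarrow> vertex set" where
  "uedge e = {fst e, snd e}"

text \<open>Loops are represented by closed walks. Passing to the quotient by cyclic rotation is
  expressed by requiring functions of loops to be invariant under \<^const>\<open>rotate\<close>.\<close>

definition is_loop :: "edge list \<Rightarrow> bool" where
  "is_loop l \<longleftrightarrow> (\<forall>e\<in>set l. lattice_edge e) \<and>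
     (\<forall>i<length l. snd (l ! i) = fst (l ! (Suc i mod length l)))"

definition removes_backtrack :: "edge list \<Rightarrow> edge list \<Rightarrow> bool" where
  "removes_backtrack l l' \<longleftrightarrow> (\<exists>n e. rotate n l = e # inv_edge e # l')"

definition has_backtrack :: "edge list \<Rightarrow> bool" where
  "has_backtrack l \<longleftrightarrow> (\<exists>l'. removes_backtrack l l')"

text \<open>The reduced loop is unique up to rotation, so the choice below is immaterial.\<close>

definition remove_backtracks :: "edge list \<Rightarrow> edge list" where
  "remove_backtracks l = (SOME l'. removes_backtrack\<^sup>*\<^sup>* l l' \<and> \<not> has_backtrack l')"

definition trivial_loop :: "edge list \<Rightarrow> bool" where
  "trivial_loop l \<longleftrightarrow> remove_backtracks l = []"

text \<open>A plaquette is given by the lower left corner of its unit square and by whether it is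
  positively oriented, i.e. clockwise, with the leftmost edge pointing upwards.\<close>

datatype plaquette = Plaquette (corner: vertex) (positive: bool)

definition plaquette_inv :: "plaquette \<Rightarrow> plaquette" where
  "plaquette_inv p = Plaquette (corner p) (\<not> positive p)"

definition plaquette_loop :: "plaquette \<Rightarrow> edge list" where
  "plaquette_loop p = (case corner p of (x, y) \<Rightarrow>
     let es = [((x, y), (x, y + 1)), ((x, y + 1), (x + 1, y + 1)),
               ((x + 1, y + 1), (x + 1, y)), ((x + 1, y), (x, y))]
     in if positive p then es else rev (map inv_edge es))"

definition plaquettes_at :: "edge \<Rightarrow> plaquette set" where
  "plaquettes_at e = {p. e \<in> set (plaquette_loop p)}"

definition adjacent :: "plaquette \<Rightarrow> plaquette \<Rightarrow> bool" where
  "adjacent p q \<longleftrightarrow>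
     card (uedge ` set (plaquette_loop p) \<inter> uedge ` set (plaquette_loop q)) = 1"

definition shared_edge :: "plaquette \<Rightarrow> plaquette \<Rightarrow> vertex set" where
  "shared_edge p q =
     (THE u. u \<in> uedge ` set (plaquette_loop p) \<inter> uedge ` set (plaquette_loop q))"

type_synonym assignment = "plaquette \<Rightarrow> nat"

text \<open>A sum of natural numbers is finite iff only finitely many terms are nonzero.\<close>

definition finite_assignment :: "assignment \<Rightarrow> bool" where
  "finite_assignment K \<longleftrightarrow> finite {p. K p \<noteq> 0}"

definition area :: "assignment \<Rightarrow> nat" where
  "area K = (\<Sum>p | K p \<noteq> 0. K p)"

definition remove_plaquette :: "assignment \<Rightarrow> plaquette \<Rightarrow> assignment" where
  "remove_plaquette K p = K(p := K p - 1)"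

definition decompositions :: "assignment \<Rightarrow> (assignment \<times> assignment) set" where
  "decompositions K = {(K1, K2). \<forall>p. K1 p + K2 p = K p}"

definition edge_count :: "edge \<Rightarrow> edge list \<Rightarrow> assignment \<Rightarrow> nat" where
  "edge_count e l K = count_list l e + (\<Sum>p\<in>plaquettes_at e. K p)"

definition balanced :: "edge list \<Rightarrow> assignment \<Rightarrow> bool" where
  "balanced l K \<longleftrightarrow>
     (\<forall>e. lattice_edge e \<longrightarrow> edge_count e l K = edge_count (inv_edge e) l K)"

text \<open>A copy of an edge in \<open>l\<close> is a position \<open>i < length l\<close>. Rotating it to the front, a second
  copy at position \<open>j\<close> of \<open>rotate i l\<close> gives \<open>rotate i l = e # \<pi> @ e' # \<rho>\<close> with
  \<open>\<pi> = take (j - 1) (tl (rotate i l))\<close> and \<open>\<rho> = drop (j + 1) (rotate i l)\<close>. The multisets of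
  splittings are indexed by these positions \<open>j\<close>.\<close>

definition pos_positions :: "nat \<Rightarrow> edge list \<Rightarrow> nat set" where
  "pos_positions i l = {j. 0 < j \<and> j < length l \<and> rotate i l ! j = l ! i}"

definition neg_positions :: "nat \<Rightarrow> edge list \<Rightarrow> nat set" where
  "neg_positions i l = {j. 0 < j \<and> j < length l \<and> rotate i l ! j = inv_edge (l ! i)}"

definition pos_split :: "nat \<Rightarrow> edge list \<Rightarrow> nat \<Rightarrow> edge list \<times> edge list" where
  "pos_split i l j =
     (l ! i # drop (j + 1) (rotate i l), take (j - 1) (tl (rotate i l)) @ [l ! i])"

definition neg_split :: "nat \<Rightarrow> edge list \<Rightarrow> nat \<Rightarrow> edge list \<times> edge list" where
  "neg_split i l j = (drop (j + 1) (rotate i l), take (j - 1) (tl (rotate i l)))"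

text \<open>The path \<open>\<pi>\<close> such that the plaquette \<open>p\<close>, read from its edge \<open>e\<close> on, is \<open>e # \<pi>\<close>.\<close>

definition plaquette_rest :: "edge \<Rightarrow> plaquette \<Rightarrow> edge list" where
  "plaquette_rest e p =
     tl (dropWhile (\<lambda>x. x \<noteq> e) (plaquette_loop p)) @ takeWhile (\<lambda>x. x \<noteq> e) (plaquette_loop p)"

definition pos_deform :: "nat \<Rightarrow> edge list \<Rightarrow> plaquette \<Rightarrow> edge list" where
  "pos_deform i l q = (let e = l ! i in e # plaquette_rest e q @ e # tl (rotate i l))"

definition neg_deform :: "nat \<Rightarrow> edge list \<Rightarrow> plaquette \<Rightarrow> edge list" where
  "neg_deform i l p = plaquette_rest (inv_edge (l ! i)) p @ tl (rotate i l)"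

definition split_term ::
  "(edge list \<Rightarrow> assignment \<Rightarrow> real) \<Rightarrow> edge list \<times> edge list \<Rightarrow> assignment \<Rightarrow> real" where
  "split_term c ls K =
     (\<Sum>(K1, K2)\<in>decompositions K. c (fst ls) K1 * c (snd ls) K2)"

definition master_loop_equation ::
  "(edge list \<Rightarrow> assignment \<Rightarrow> real) \<Rightarrow> edge list \<Rightarrow> assignment \<Rightarrow> nat \<Rightarrow> bool" where
  "master_loop_equation c l K i \<longleftrightarrow>
     c l K =
       (\<Sum>j\<in>neg_positions i l. split_term c (neg_split i l j) K)
     - (\<Sum>j\<in>pos_positions i l. split_term c (pos_split i l j) K)
     + (\<Sum>p | p \<in> plaquettes_at (inv_edge (l ! i)) \<and> K p \<ge> 1.
          c (neg_deform i l p) (remove_plaquette K p))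
     - (\<Sum>q | q \<in> plaquettes_at (l ! i) \<and> K q \<ge> 1.
          c (pos_deform i l q) (remove_plaquette K q))"

text \<open>The first conjunct says that \<open>c\<close> is a function of loops, i.e. of closed walks up to
  rotation. The remaining ones determine \<open>c\<close> on loops and finite assignments, by recursion on
  the area of the assignment and the length of the loop.\<close>

definition surface_coefficients :: "(edge list \<Rightarrow> assignment \<Rightarrow> real) \<Rightarrow> bool" where
  "surface_coefficients c \<longleftrightarrow>
     (\<forall>l K n. is_loop l \<longrightarrow> finite_assignment K \<longrightarrow> c (rotate n l) K = c l K) \<and>
     (\<forall>l K. is_loop l \<longrightarrow> finite_assignment K \<longrightarrow> \<not> balanced l K \<longrightarrow> c l K = 0) \<and>
     (\<forall>l. is_loop l \<longrightarrow> \<not> trivial_loop l \<longrightarrow> c l (\<lambda>_. 0) = 0) \<and>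
     c [] (\<lambda>_. 0) = 1 \<and>
     (\<forall>K. finite_assignment K \<longrightarrow> K \<noteq> (\<lambda>_. 0) \<longrightarrow> c [] K = 0) \<and>
     (\<forall>l K. is_loop l \<longrightarrow> l \<noteq> [] \<longrightarrow> finite_assignment K \<longrightarrow>
        (\<forall>i<length l. master_loop_equation c l K i))"

definition phi_term ::
  "(edge list \<Rightarrow> assignment \<Rightarrow> real) \<Rightarrow> real \<Rightarrow> edge list \<Rightarrow> assignment \<Rightarrow> real" where
  "phi_term c \<beta> l K = c l K * \<beta> ^ area K"

definition phi :: "(edge list \<Rightarrow> assignment \<Rightarrow> real) \<Rightarrow> real \<Rightarrow> edge list \<Rightarrow> real" where
  "phi c \<beta> l = (\<Sum>\<^sub>\<infinity>K | finite_assignment K. phi_term c \<beta> l K)"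

text \<open>For adjacent \<open>p\<close>, \<open>q\<close>, the sign of the cross product of the direction from the center of
  \<open>p\<close> to that of \<open>q\<close> with the direction of \<open>e\<close>: it is positive if an edge \<open>e\<close> separating the
  two squares crosses that segment from right to left, negative if from left to right.\<close>

definition crossing_sign :: "plaquette \<Rightarrow> plaquette \<Rightarrow> edge \<Rightarrow> int" where
  "crossing_sign p q e =
     sgn ((fst (corner q) - fst (corner p)) * (snd (snd e) - snd (fst e)) -
          (snd (corner q) - snd (corner p)) * (fst (snd e) - fst (fst e)))"

definition crossings_right_to_left :: "edge list \<Rightarrow> plaquette \<Rightarrow> plaquette \<Rightarrow> nat" where
  "crossings_right_to_left l p q =
     length (filter (\<lambda>e. uedge e = shared_edge p q \<and> crossing_sign p q e = 1) l)"

definition crossings_left_to_right :: "edge list \<Rightarrow> plaquette \<Rightarrow> plaquette \<Rightarrow> nat" where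
  "crossings_left_to_right l p q =
     length (filter (\<lambda>e. uedge e = shared_edge p q \<and> crossing_sign p q e = -1) l)"

definition in_lattice_box :: "int \<Rightarrow> vertex \<Rightarrow> bool" where
  "in_lattice_box B v \<longleftrightarrow> \<bar>fst v\<bar> \<le> B \<and> \<bar>snd v\<bar> \<le> B"

definition is_height :: "edge list \<Rightarrow> (plaquette \<Rightarrow> int) \<Rightarrow> bool" where
  "is_height l h \<longleftrightarrow>
     (\<forall>p. h (plaquette_inv p) = h p) \<and>
     (\<exists>B. (\<forall>e\<in>set l. \<forall>v\<in>uedge e. in_lattice_box B v) \<and>
          (\<forall>p. \<not> (\<forall>e\<in>set (plaquette_loop p). \<forall>v\<in>uedge e. in_lattice_box B v) \<longrightarrow> h p = 0)) \<and>
     (\<forall>p q. positive p \<longrightarrow> positive q \<longrightarrow> adjacent p q \<longrightarrow>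
        h q = h p + int (crossings_right_to_left l p q) - int (crossings_left_to_right l p q))"

definition height :: "edge list \<Rightarrow> plaquette \<Rightarrow> int" where
  "height l = (THE h. is_height l h)"

definition uedge_count :: "vertex set \<Rightarrow> edge list \<Rightarrow> nat" where
  "uedge_count u l = length (filter (\<lambda>e. uedge e = u) l)"

definition infinite_plaquette_path :: "(nat \<Rightarrow> plaquette) \<Rightarrow> bool" where
  "infinite_plaquette_path P \<longleftrightarrow>
     inj P \<and> (\<forall>i. positive (P i)) \<and> (\<forall>i. adjacent (P i) (P (Suc i)))"

text \<open>As the plaquettes of a path are distinct, it crosses each edge at most once, so that only
  finitely many terms of the sum below are nonzero.\<close>

definition path_crossings :: "edge list \<Rightarrow> (nat \<Rightarrow> plaquette) \<Rightarrow> nat" where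
  "path_crossings l P = (\<Sum>i. uedge_count (shared_edge (P i) (P (Suc i))) l)"

definition distance :: "edge list \<Rightarrow> plaquette \<Rightarrow> nat" where
  "distance l p = (LEAST k. \<exists>P. infinite_plaquette_path P \<and>
     P 0 = Plaquette (corner p) True \<and> path_crossings l P = k)"

definition plane_point :: "vertex \<Rightarrow> real \<times> real" where
  "plane_point v = (real_of_int (fst v), real_of_int (snd v))"

definition loop_trace :: "edge list \<Rightarrow> (real \<times> real) set" where
  "loop_trace l = (\<Union>e\<in>set l. closed_segment (plane_point (fst e)) (plane_point (snd e)))"

definition unit_square :: "plaquette \<Rightarrow> (real \<times> real) set" where
  "unit_square p = box (plane_point (corner p)) (plane_point (corner p) + (1, 1))"

definition same_region :: "edge list \<Rightarrow> plaquette \<Rightarrow> plaquette \<Rightarrow> bool" where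
  "same_region l p q \<longleftrightarrow>
     (\<exists>C\<in>components (- loop_trace l). unit_square p \<subseteq> C \<and> unit_square q \<subseteq> C)"

definition height_assignment :: "edge list \<Rightarrow> assignment" where
  "height_assignment l p =
     (if positive p then (if height l p \<ge> 0 then 0 else nat \<bar>height l p\<bar>)
      else (if height l p \<ge> 0 then nat \<bar>height l p\<bar> else 0))"

definition canonical_reduced :: "edge list \<Rightarrow> assignment set" where
  "canonical_reduced l = {K. finite_assignment K \<and>
     (\<exists>K'. (\<forall>p. K p = height_assignment l p + K' p) \<and>
       (\<forall>p. K' p = K' (plaquette_inv p)) \<and>
       (\<forall>p q. positive p \<longrightarrow> positive q \<longrightarrow> same_region l p q \<longrightarrow> K' p = K' q) \<and>
       (\<forall>p. positive p \<longrightarrow>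
          real (K' p) \<le> (real (distance l p) - real_of_int \<bar>height l p\<bar>) / 2))}"

definition canonical_collection :: "edge list \<Rightarrow> assignment set" where
  "canonical_collection l =
     (if has_backtrack l then canonical_reduced (remove_backtracks l) else canonical_reduced l)"

end

theory Submission
  imports Defs
begin

text \<open>Write $M(p) = K(p) + K(p^{-1})$ for the number of copies of the square \<open>p\<close>, in either orientation,
  that \<open>K\<close> contains; this is \<open>square_count\<close>. The theorem rests on one estimate,
  \<open>square_count_lipschitz\<close>: if \<open>c l K \<noteq> 0\<close>, then \<open>M\<close> changes across an edge by at most the number of
  times \<open>l\<close> runs along that edge.

  The estimate implies that \<open>K\<close> is canonical. As \<open>(l, K)\<close> is balanced, $K(p^{-1}) - K(p)$ satisfies the
  rules that define the height \<open>h\<close>, so \<open>K\<close> is the height assignment plus a symmetric \<open>K'\<close>, and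
  $M = |h| + 2K'$. Across an edge that \<open>l\<close> avoids, neither \<open>M\<close> nor \<open>h\<close> changes, hence \<open>K'\<close> is constant on
  the regions of \<open>l\<close>. Summed along a path of squares that leaves the finite support of \<open>K\<close>, the
  estimate says that $M(p)$ is at most the number of crossings, so that $|h| + 2K' \leq d$. The same
  bound leaves only finitely many \<open>K\<close> with \<open>c l K \<noteq> 0\<close>, which makes the sum converge. A loop with
  backtracks has the same coefficients as its reduction: the master loop equations at the two edges
  of a backtrack $e e^{-1}$ have the same terms with opposite signs, apart from the coefficient of
  the shortened loop (\<open>c_backtrack\<close>).

  The estimate is proved by induction on a weight that decreases along the master loop equation.
  Let \<open>p\<close>, \<open>q\<close> be the squares at \<open>e\<close>. If \<open>l\<close> has an edge on neither square, the terms of the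
  equation at that edge involve the same numbers of copies of \<open>p\<close>, \<open>q\<close> and \<open>e\<close>, so that they all
  vanish by induction if the inequality fails (\<open>far_step\<close>). If \<open>l\<close> contains \<open>e\<close>, the equation at \<open>e\<close> works as
  well, with one exception: the positive deformation by \<open>p\<close> uses up a copy of \<open>p\<close> but adds a copy of \<open>e\<close>. It yields a
  loop that runs along \<open>e\<close> and then once around \<open>p\<close>. The induction therefore proves a bound that is
  better by \<open>m\<close> for loops that first wind \<open>m\<close> times around \<open>p\<close> (\<open>excess_step\<close>). For these the
  exceptional term is covered by the bound for \<open>m + 1\<close>, and the two other large
  terms, in which one turn around \<open>p\<close> is split off or is undone by a negative deformation, cancel. That
  they are equal is because the coefficients of the powers of a plaquette vanish, except that of its
  first power with the inverse plaquette as assignment (\<open>power_step\<close>). Finally, if \<open>l\<close> has no backtrack,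
  avoids \<open>e\<close> and stays on \<open>p\<close> and \<open>q\<close>, then it winds around the domino that they form, and balance
  forces $M(p) = M(q)$ (\<open>domino_horizontal\<close>, \<open>domino_vertical\<close>).\<close>

section \<open>Closed walks\<close>

text \<open>Vertices are pairs, but the intermediate vertices of a walk should remain variables.\<close>

declare split_paired_Ex [simp del]

fun walk :: "vertex \<Rightarrow> edge list \<Rightarrow> vertex \<Rightarrow> bool" where
  "walk u [] v = (u = v)"
| "walk u (e # es) v = (lattice_edge e \<and> fst e = u \<and> walk (snd e) es v)"

lemma walk_append [simp]: "walk u (xs @ ys) w \<longleftrightarrow> (\<exists>v. walk u xs v \<and> walk v ys w)"
  by (induction xs arbitrary: u) auto

lemma walk_iff_nth:
  assumes "l \<noteq> []"
  shows "walk u l v \<longleftrightarrow> (\<forall>e\<in>set l. lattice_edge e) \<and> fst (hd l) = u \<and> snd (last l) = v \<and>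
    (\<forall>i. Suc i < length l \<longrightarrow> snd (l ! i) = fst (l ! Suc i))"
  using assms
proof (induction l arbitrary: u)
  case Nil
  then show ?case by simp
next
  case (Cons e l)
  show ?case
  proof (cases "l = []")
    case True
    then show ?thesis by auto
  next
    case False
    have "(\<forall>i. Suc i < length (e # l) \<longrightarrow> snd ((e # l) ! i) = fst ((e # l) ! Suc i)) \<longleftrightarrow>
        snd e = fst (hd l) \<and> (\<forall>i. Suc i < length l \<longrightarrow> snd (l ! i) = fst (l ! Suc i))"
      (is "(\<forall>i. ?P i) \<longleftrightarrow> _")
    proof -
      have "(\<forall>i. ?P i) \<longleftrightarrow> ?P 0 \<and> (\<forall>i. ?P (Suc i))"
        by (metis (no_types, lifting) not0_implies_Suc)
      then show ?thesis using False by (simp add: hd_conv_nth)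
    qed
    then show ?thesis using Cons.IH[OF False] False by auto
  qed
qed

lemma is_loop_iff_walk: "is_loop l \<longleftrightarrow> (\<exists>v. walk v l v)"
proof (cases "l = []")
  case True
  then show ?thesis by (simp add: is_loop_def)
next
  case False
  have "(\<forall>i<length l. snd (l ! i) = fst (l ! (Suc i mod length l))) \<longleftrightarrow>
    snd (last l) = fst (hd l) \<and> (\<forall>i. Suc i < length l \<longrightarrow> snd (l ! i) = fst (l ! Suc i))"
    (is "?L = ?R")
  proof
    assume L: ?L
    have "snd (l ! (length l - 1)) = fst (l ! (Suc (length l - 1) mod length l))"
      using L False by (metis diff_less length_greater_0_conv zero_less_one)
    then have "snd (last l) = fst (hd l)"
      using False by (simp add: last_conv_nth hd_conv_nth)
    moreover have "snd (l ! i) = fst (l ! Suc i)" if "Suc i < length l" for i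
      using L that by (metis Suc_lessD mod_less)
    ultimately show ?R by blast
  next
    assume R: ?R
    show ?L
    proof (intro allI impI)
      fix i assume i: "i < length l"
      show "snd (l ! i) = fst (l ! (Suc i mod length l))"
      proof (cases "Suc i < length l")
        case True
        then show ?thesis using R by simp
      next
        case F: False
        then have "Suc i = length l" using i by simp
        then show ?thesis using R False
          by (metis diff_Suc_1 hd_conv_nth last_conv_nth mod_self)
      qed
    qed
  qed
  then show ?thesis using False by (auto simp: is_loop_def walk_iff_nth)
qed

lemma is_loop_Nil [simp]: "is_loop []"
  by (simp add: is_loop_def)

lemma is_loop_Cons [simp]: "is_loop (e # w) \<longleftrightarrow> lattice_edge e \<and> walk (snd e) w (fst e)"
  by (auto simp: is_loop_iff_walk)

lemma is_loop_append: "is_loop (xs @ ys) \<longleftrightarrow> (\<exists>u v. walk u xs v \<and> walk v ys u)"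
  by (auto simp: is_loop_iff_walk)

lemma is_loop_commute: "is_loop (xs @ ys) \<longleftrightarrow> is_loop (ys @ xs)"
  by (auto simp: is_loop_append)

lemma is_loop_rotate: "is_loop (rotate n l) \<longleftrightarrow> is_loop l"
  by (metis append_take_drop_id is_loop_commute rotate_drop_take)

lemma walk_split:
  assumes "walk u w v" "i < length w" "w ! i = x"
  shows "walk u (take i w) (fst x)" "walk (snd x) (drop (Suc i) w) v" "lattice_edge x"
  using assms id_take_nth_drop[OF assms(2)] by (metis walk.simps(2) walk_append)+

lemma lattice_edge_inv [simp]: "lattice_edge (inv_edge e) \<longleftrightarrow> lattice_edge e"
  by (auto simp: lattice_edge_def)

lemma inv_edge_neq: "lattice_edge e \<Longrightarrow> inv_edge e \<noteq> e"
  by (cases e) (auto simp: lattice_edge_def)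

lemma walk_rev: "walk u (rev (map inv_edge l)) v \<longleftrightarrow> walk v l u"
  by (induction l arbitrary: u v) auto

lemma loop_succ:
  assumes "is_loop l" "k < length l"
  shows "snd (l ! k) = fst (l ! (Suc k mod length l))"
  using assms by (simp add: is_loop_def)

section \<open>Backtracks and loops on a cycle\<close>

lemma backtrackI:
  assumes "is_loop l" "k < length l" "l ! (Suc k mod length l) = inv_edge (l ! k)"
  shows "has_backtrack l"
proof -
  have "length l \<noteq> 1"
  proof
    assume "length l = 1"
    then obtain e where "l = [e]" by (metis One_nat_def length_0_conv length_Suc_conv)
    then show False using assms inv_edge_neq[of e] by simp
  qed
  then have "Suc 0 < length l" using assms(2) by linarith
  then have len: "Suc 0 < length (rotate k l)" by simp
  have *: "Suc 0 < length xs \<Longrightarrow> \<exists>a b r. xs = a # b # r" for xs :: "edge list"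
    by (cases xs; cases "tl xs") auto
  obtain a b r where r: "rotate k l = a # b # r" using *[OF len] by blast
  have "0 < length l" using assms(2) by linarith
  then have "a = l ! k" using nth_rotate[of 0 l k] assms(2) r by simp
  moreover have "b = l ! (Suc k mod length l)"
    using nth_rotate[of "Suc 0" l k] \<open>Suc 0 < length l\<close> r by simp
  ultimately show ?thesis
    using assms(3) r unfolding has_backtrack_def removes_backtrack_def by metis
qed

lemma ex_removes_backtracks: "\<exists>l'. removes_backtrack\<^sup>*\<^sup>* l l' \<and> \<not> has_backtrack l'"
proof (induction "length l" arbitrary: l rule: less_induct)
  case less
  show ?case
  proof (cases "has_backtrack l")
    case True
    then obtain l1 where l1: "removes_backtrack l l1" unfolding has_backtrack_def by blast
    then obtain n e where "rotate n l = e # inv_edge e # l1" unfolding removes_backtrack_def by blast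
    from arg_cong[OF this, of length] have "length l1 < length l" by simp
    then obtain l' where "removes_backtrack\<^sup>*\<^sup>* l1 l'" "\<not> has_backtrack l'" using less by blast
    then show ?thesis using l1 by (meson converse_rtranclp_into_rtranclp)
  qed blast
qed

lemma remove_backtracks_reaches: "removes_backtrack\<^sup>*\<^sup>* l (remove_backtracks l)"
  unfolding remove_backtracks_def using someI_ex[OF ex_removes_backtracks[of l]] by blast

text \<open>Without backtracks, the only way to go on after \<open>(v i, v (i + 1))\<close> is \<open>(v (i + 1), v (i + 2))\<close>, so one
  forward edge starts a run that is forward forever and passes all edges of the cycle.\<close>

lemma reduced_loop_in_cycle_forward:
  fixes v :: "int \<Rightarrow> vertex" and N :: int
  assumes v: "\<And>i j. v i = v j \<longleftrightarrow> i mod N = j mod N" and N: "N \<ge> 3"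
    and loop: "is_loop l" "\<not> has_backtrack l"
    and cyc: "\<And>f. f \<in> set l \<Longrightarrow> \<exists>i. f = (v i, v (i + 1)) \<or> f = (v (i + 1), v i)"
    and ex: "(v i0, v (i0 + 1)) \<in> set l"
  shows "(v j, v (j + 1)) \<in> set l \<and> (v (j + 1), v j) \<notin> set l"
proof -
  let ?n = "length l"
  obtain k0 where k0: "k0 < ?n" "l ! k0 = (v i0, v (i0 + 1))" using ex by (metis in_set_conv_nth)
  have n: "?n > 0" using k0 by linarith
  have shift: "v (i + d) = v (j + d)" if "v i = v j" for i j d
    using that v by (metis mod_add_cong)
  have run: "l ! ((k0 + k) mod ?n) = (v (i0 + int k), v (i0 + int k + 1))" for k
  proof (induction k)
    case 0
    then show ?case using k0 by simp
  next
    case (Suc k)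
    let ?k = "(k0 + k) mod ?n" and ?i = "i0 + int k"
    have kn: "?k < ?n" using n by simp
    have ks: "Suc ?k mod ?n = (k0 + Suc k) mod ?n" by (simp add: mod_Suc_eq)
    let ?g = "l ! (Suc ?k mod ?n)"
    have "?g \<in> set l" using n by simp
    have fg: "fst ?g = v (?i + 1)" using loop_succ[OF loop(1) kn] Suc.IH by simp
    have ng: "?g \<noteq> (v (?i + 1), v ?i)"
      using backtrackI[OF loop(1) kn] loop(2) Suc.IH by auto
    from cyc[OF \<open>?g \<in> set l\<close>] obtain i where "?g = (v i, v (i + 1)) \<or> ?g = (v (i + 1), v i)" by blast
    then show ?case
    proof
      assume g: "?g = (v i, v (i + 1))"
      then have "v i = v (?i + 1)" using fg by simp
      then have "v (i + 1) = v (?i + 1 + 1)" by (rule shift)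
      then show ?thesis using g fg ks by (simp add: add.assoc add.commute add.left_commute)
    next
      assume g: "?g = (v (i + 1), v i)"
      then have "v (i + 1) = v (?i + 1)" using fg by simp
      from shift[OF this, of "-1"] have "v i = v ?i" by simp
      then show ?thesis using g fg ng by simp
    qed
  qed
  have all: "\<exists>i. f = (v i, v (i + 1))" if f: "f \<in> set l" for f
  proof -
    obtain k where k: "k < ?n" "l ! k = f" using f unfolding in_set_conv_nth by blast
    have "(k0 + (k + ?n - k0)) mod ?n = k" using k k0(1) by simp
    then have "f = (v (i0 + int (k + ?n - k0)), v (i0 + int (k + ?n - k0) + 1))"
      using run[of "k + ?n - k0"] k(2) by simp
    then show ?thesis by blast
  qed
  have "(v j, v (j + 1)) \<in> set l"
  proof -
    let ?k = "nat ((j - i0) mod N)"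
    have "int ?k = (j - i0) mod N" using N by simp
    then have "(i0 + int ?k) mod N = j mod N" by (simp add: mod_add_right_eq)
    then have e: "v (i0 + int ?k) = v j" using v by blast
    then have "v (i0 + int ?k + 1) = v (j + 1)" by (rule shift)
    then have "l ! ((k0 + ?k) mod ?n) = (v j, v (j + 1))" using run[of ?k] e by simp
    then show ?thesis using n by (metis mod_less_divisor nth_mem)
  qed
  moreover have "(v (j + 1), v j) \<notin> set l"
  proof
    assume "(v (j + 1), v j) \<in> set l"
    then obtain i where i: "v (j + 1) = v i" "v j = v (i + 1)" using all by fastforce
    \<comment> \<open>a backward edge that is also forward would make the cycle have length at most 2\<close>
    have "v (j - 1) = v i" using shift[OF i(2), of "-1"] by simp
    then have "(j + 1) mod N = (j - 1) mod N" using i(1) v by metis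
    then have "N dvd (j + 1) - (j - 1)" by (simp only: mod_eq_dvd_iff)
    then have "N dvd 2" by simp
    then show False using N zdvd_imp_le[of N 2] by simp
  qed
  ultimately show ?thesis ..
qed

text \<open>A reduced loop that stays on a cycle winds around it in one direction. A winding in the backward
  direction is forward for the reversed numbering of the vertices.\<close>

lemma reduced_loop_in_cycle:
  assumes "distinct vs" "length vs \<ge> 3" "is_loop l" "\<not> has_backtrack l" "l \<noteq> []"
    and zcyc: "\<And>f. f \<in> set l \<Longrightarrow> f \<in> set (zip vs (rotate1 vs)) \<or> inv_edge f \<in> set (zip vs (rotate1 vs))"
    and zf: "f \<in> set (zip vs (rotate1 vs))"
  shows "f \<in> set l \<longleftrightarrow> inv_edge f \<notin> set l"
proof -
  have zip: "\<exists>k<length vs. g = (vs ! k, vs ! (Suc k mod length vs))" if "g \<in> set (zip vs (rotate1 vs))" for g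
    using that by (auto simp: set_zip nth_rotate1)
  have cyc: "\<exists>k<length vs. g = (vs ! k, vs ! (Suc k mod length vs)) \<or> inv_edge g = (vs ! k, vs ! (Suc k mod length vs))"
    if "g \<in> set l" for g
    using zcyc[OF that] zip[of g] zip[of "inv_edge g"] by blast
  obtain k where k: "k < length vs" and f: "f = (vs ! k, vs ! (Suc k mod length vs))"
    using zip[OF zf] by blast
  let ?N = "int (length vs)"
  define v where "v i = vs ! nat (i mod ?N)" for i :: int
  have N: "?N \<ge> 3" using assms(2) by simp
  have lt: "nat (i mod ?N) < length vs" for i 
  proof -
    have "0 \<le> i mod ?N" "i mod ?N < ?N" using N by (intro pos_mod_sign pos_mod_bound; linarith)+
    then show ?thesis by linarith
  qed
  have v: "v i = v j \<longleftrightarrow> i mod ?N = j mod ?N" for i j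
  proof -
    have "v i = v j \<longleftrightarrow> nat (i mod ?N) = nat (j mod ?N)"
      unfolding v_def using assms(1) lt by (simp add: nth_eq_iff_index_eq)
    also have "\<dots> \<longleftrightarrow> i mod ?N = j mod ?N"
    proof (rule eq_nat_nat_iff)
      have "0 < ?N" using N by linarith
      then show "0 \<le> i mod ?N" "0 \<le> j mod ?N" by (rule pos_mod_sign)+
    qed
    finally show ?thesis .
  qed
  have vk: "v (int k) = vs ! k" "v (int k + 1) = vs ! (Suc k mod length vs)" if "k < length vs" for k
    using that by (simp_all add: v_def nat_mod_distrib zmod_int[symmetric] flip: of_nat_Suc)
       (metis nat_int of_nat_Suc add.commute zmod_int)
  have cyc': "\<exists>i. f = (v i, v (i + 1)) \<or> f = (v (i + 1), v i)" if f: "f \<in> set l" for f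
  proof -
    obtain k where k: "k < length vs" "f = (v (int k), v (int k + 1)) \<or> inv_edge f = (v (int k), v (int k + 1))"
      using cyc[OF f] vk by metis
    then show ?thesis by (metis swap_simp swap_swap)
  qed
  define u where "u i = v (- i)" for i :: int
  have u: "u i = u j \<longleftrightarrow> i mod ?N = j mod ?N" for i j
    unfolding u_def v by (metis minus_minus mod_minus_cong)
  have cycu: "\<exists>i. f = (u i, u (i + 1)) \<or> f = (u (i + 1), u i)" if f: "f \<in> set l" for f
  proof -
    obtain i where "f = (v i, v (i + 1)) \<or> f = (v (i + 1), v i)" using cyc'[OF f] by blast
    then have "f = (u (- i - 1 + 1), u (- i - 1)) \<or> f = (u (- i - 1), u (- i - 1 + 1))" by (simp add: u_def add.commute)
    then show ?thesis by blast
  qed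
  have f': "f = (v (int k), v (int k + 1))" "inv_edge f = (v (int k + 1), v (int k))"
    using f vk[OF k] by simp_all
  obtain g where "g \<in> set l" using assms(5) by (cases l) auto
  then obtain i where i: "(v i, v (i + 1)) \<in> set l \<or> (v (i + 1), v i) \<in> set l" using cyc' by metis
  then show ?thesis
  proof
    assume "(v i, v (i + 1)) \<in> set l"
    from reduced_loop_in_cycle_forward[OF v N assms(3,4) cyc' this, of "int k"]
    show ?thesis using f' by simp
  next
    assume "(v (i + 1), v i) \<in> set l"
    then have "(u (- i - 1), u (- i - 1 + 1)) \<in> set l" by (simp add: u_def add.commute)
    from reduced_loop_in_cycle_forward[OF u N assms(3,4) cycu this, of "- int k - 1"]
    show ?thesis using f' by (auto simp: u_def add.commute)
  qed
qed

section \<open>Plaquettes and their edges\<close>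

lemma plaquette_loop_pos: "plaquette_loop (Plaquette (x, y) True) =
    [((x, y), (x, y + 1)), ((x, y + 1), (x + 1, y + 1)),
     ((x + 1, y + 1), (x + 1, y)), ((x + 1, y), (x, y))]"
  by (simp add: plaquette_loop_def)

lemma plaquette_loop_neg: "plaquette_loop (Plaquette (x, y) False) =
    [((x, y), (x + 1, y)), ((x + 1, y), (x + 1, y + 1)),
     ((x + 1, y + 1), (x, y + 1)), ((x, y + 1), (x, y))]"
  by (simp add: plaquette_loop_def)

lemma plaquette_cases:
  obtains x y where "p = Plaquette (x, y) True" | x y where "p = Plaquette (x, y) False"
  by (metis plaquette.exhaust surj_pair)

lemma plaquette_inv_simps [simp]:
  "plaquette_inv (Plaquette v b) = Plaquette v (\<not> b)"
  "plaquette_inv (plaquette_inv p) = p"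
  "plaquette_inv p \<noteq> p" "p \<noteq> plaquette_inv p"
  "corner (plaquette_inv p) = corner p"
  by (simp add: plaquette_inv_def, simp add: plaquette_inv_def,
      (cases p, simp add: plaquette_inv_def)+)

lemma plaquette_inv_eq_iff: "plaquette_inv p = plaquette_inv q \<longleftrightarrow> p = q"
  by (metis plaquette_inv_simps(2))

lemma lattice_edge_cases:
  assumes "lattice_edge e"
  obtains (up) x y where "e = ((x, y), (x, y + 1))"
  | (down) x y where "e = ((x, y + 1), (x, y))"
  | (right) x y where "e = ((x, y), (x + 1, y))"
  | (left) x y where "e = ((x + 1, y), (x, y))"
proof -
  obtain a b a' b' where e: "e = ((a, b), (a', b'))" by (metis surj_pair)
  have "\<bar>a' - a\<bar> + \<bar>b' - b\<bar> = 1" using assms by (simp add: e lattice_edge_def)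
  then have "a' = a \<and> b' = b + 1 \<or> a' = a \<and> b = b' + 1 \<or> b' = b \<and> a' = a + 1 \<or> b' = b \<and> a = a' + 1"
    by linarith
  then show ?thesis using that e by blast
qed

lemma edge_of_square_iff:
  "((a, b), (a, b + 1)) \<in> set (plaquette_loop (Plaquette (x, y) s)) \<longleftrightarrow> b = y \<and> (if s then x = a else x + 1 = a)"
  "((a, b + 1), (a, b)) \<in> set (plaquette_loop (Plaquette (x, y) s)) \<longleftrightarrow> b = y \<and> (if s then x + 1 = a else x = a)"
  "((a, b), (a + 1, b)) \<in> set (plaquette_loop (Plaquette (x, y) s)) \<longleftrightarrow> x = a \<and> (if s then y + 1 = b else y = b)"
  "((a + 1, b), (a, b)) \<in> set (plaquette_loop (Plaquette (x, y) s)) \<longleftrightarrow> x = a \<and> (if s then y = b else y + 1 = b)"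
  by (cases s; auto simp: plaquette_loop_pos plaquette_loop_neg)+

lemma plaquettes_at_simps:
  "plaquettes_at ((x, y), (x, y + 1)) = {Plaquette (x, y) True, Plaquette (x - 1, y) False}"
  "plaquettes_at ((x, y + 1), (x, y)) = {Plaquette (x, y) False, Plaquette (x - 1, y) True}"
  "plaquettes_at ((x, y), (x + 1, y)) = {Plaquette (x, y - 1) True, Plaquette (x, y) False}"
  "plaquettes_at ((x + 1, y), (x, y)) = {Plaquette (x, y - 1) False, Plaquette (x, y) True}"
  unfolding plaquettes_at_def set_eq_iff
  by (rule allI, rule_tac p = xa in plaquette_cases;
      force simp add: edge_of_square_iff)+

lemma plaquettes_at_pair:
  assumes "lattice_edge e"
  obtains p q where "p \<noteq> q" "p \<noteq> plaquette_inv q" "plaquettes_at e = {p, q}"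
  using assms
proof (cases e rule: lattice_edge_cases)
  case (up x y)
  show ?thesis by (rule that[OF _ _ plaquettes_at_simps(1)[of x y, folded up]]) simp_all
next
  case (down x y)
  show ?thesis by (rule that[OF _ _ plaquettes_at_simps(2)[of x y, folded down]]) simp_all
next
  case (right x y)
  show ?thesis by (rule that[OF _ _ plaquettes_at_simps(3)[of x y, folded right]]) simp_all
next
  case (left x y)
  show ?thesis by (rule that[OF _ _ plaquettes_at_simps(4)[of x y, folded left]]) simp_all
qed

lemma finite_plaquettes_at: "lattice_edge e \<Longrightarrow> finite (plaquettes_at e)"
  by (metis finite.emptyI finite_insert plaquettes_at_pair)

lemma plaquette_loop_inv: "plaquette_loop (plaquette_inv p) = rev (map inv_edge (plaquette_loop p))"
  by (cases p rule: plaquette_cases) (simp_all add: plaquette_loop_pos plaquette_loop_neg)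

lemma inv_edge_in_plaquette_loop:
  "inv_edge e \<in> set (plaquette_loop (plaquette_inv p)) \<longleftrightarrow> e \<in> set (plaquette_loop p)"
  by (simp add: plaquette_loop_inv inj_image_mem_iff)

lemma plaquettes_at_inv: "plaquettes_at (inv_edge e) = plaquette_inv ` plaquettes_at e"
proof -
  have "p \<in> plaquettes_at (inv_edge e) \<longleftrightarrow> p \<in> plaquette_inv ` plaquettes_at e" for p
    using inv_edge_in_plaquette_loop[of e "plaquette_inv p"]
    by (simp add: plaquettes_at_def image_iff) (metis plaquette_inv_simps(2))
  then show ?thesis by blast
qed

lemma plaquette_rest_cases:
  assumes "p \<in> plaquettes_at e"
  obtains (rot) xs ys where "plaquette_loop p = xs @ e # ys" "plaquette_rest e p = ys @ xs" "e \<notin> set xs"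
proof -
  obtain xs ys where p: "plaquette_loop p = xs @ e # ys" and e: "e \<notin> set xs"
    using assms split_list_first[of e "plaquette_loop p"] by (auto simp: plaquettes_at_def)
  have "\<And>x. x \<in> set xs \<Longrightarrow> x \<noteq> e" using e by blast
  then have "plaquette_rest e p = ys @ xs"
    unfolding plaquette_rest_def p by (subst dropWhile_append2, assumption, subst takeWhile_append2, assumption) simp
  then show ?thesis using p e rot by blast
qed

lemma plaquette_loop_props:
  "is_loop (plaquette_loop p)" "distinct (plaquette_loop p)" "length (plaquette_loop p) = 4"
  "e \<in> set (plaquette_loop p) \<Longrightarrow> inv_edge e \<notin> set (plaquette_loop p)"
proof -
  show "is_loop (plaquette_loop p)" "distinct (plaquette_loop p)" "length (plaquette_loop p) = 4"
    by (cases p rule: plaquette_cases; simp add: plaquette_loop_pos plaquette_loop_neg lattice_edge_def)+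
  show "inv_edge e \<notin> set (plaquette_loop p)" if "e \<in> set (plaquette_loop p)"
    using that
    by (cases p rule: plaquette_cases) (auto simp: plaquette_loop_pos plaquette_loop_neg)
qed

text \<open>The path \<open>plaquette_rest e p\<close> is the part of the plaquette from the end of \<open>e\<close> back to its start. Read
  backwards, it is the path that a negative deformation by the inverse plaquette inserts.\<close>

lemma plaquette_rest_props:
  assumes "p \<in> plaquettes_at e"
  shows "walk (snd e) (plaquette_rest e p) (fst e)"
    and "set (e # plaquette_rest e p) = set (plaquette_loop p)"
    and "e \<notin> set (plaquette_rest e p)" "inv_edge e \<notin> set (plaquette_rest e p)"
    and "length (plaquette_rest e p) = 3"
    and "plaquette_rest (inv_edge e) (plaquette_inv p) = rev (map inv_edge (plaquette_rest e p))"
proof -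
  from assms obtain xs ys where p: "plaquette_loop p = xs @ e # ys"
    and r: "plaquette_rest e p = ys @ xs" and x: "e \<notin> set xs"
    by (rule plaquette_rest_cases)
  have d: "e \<notin> set ys" "inv_edge e \<notin> set xs" "inv_edge e \<notin> set ys"
    using plaquette_loop_props(2)[of p] plaquette_loop_props(4)[of e p] p by auto
  show "walk (snd e) (plaquette_rest e p) (fst e)"
    using plaquette_loop_props(1)[of p] unfolding p r is_loop_append walk_append walk.simps by blast
  show "set (e # plaquette_rest e p) = set (plaquette_loop p)" by (auto simp: p r)
  show "e \<notin> set (plaquette_rest e p)" "inv_edge e \<notin> set (plaquette_rest e p)"
    using d x by (auto simp: r)
  show "length (plaquette_rest e p) = 3" using plaquette_loop_props(3)[of p] by (simp add: p r)
  have "inv_edge e \<in> set (plaquette_loop (plaquette_inv p))"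
    by (simp add: inv_edge_in_plaquette_loop p)
  then have "plaquette_inv p \<in> plaquettes_at (inv_edge e)" by (simp add: plaquettes_at_def)
  then show "plaquette_rest (inv_edge e) (plaquette_inv p) = rev (map inv_edge (plaquette_rest e p))"
  proof (rule plaquette_rest_cases)
    fix us vs
    assume q: "plaquette_loop (plaquette_inv p) = us @ inv_edge e # vs"
      and r': "plaquette_rest (inv_edge e) (plaquette_inv p) = vs @ us"
      and u: "inv_edge e \<notin> set us"
    have "us @ inv_edge e # vs = rev (map inv_edge ys) @ inv_edge e # rev (map inv_edge xs)"
      by (simp add: q[symmetric] plaquette_loop_inv p)
    moreover have "inv_edge e \<notin> set (rev (map inv_edge ys))" "inv_edge e \<notin> set (rev (map inv_edge xs))"
      using d(1) x by (simp_all add: inj_image_mem_iff)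
    ultimately have "us = rev (map inv_edge ys) \<and> vs = rev (map inv_edge xs)"
      using append_Cons_eq_iff[of "inv_edge e" "rev (map inv_edge ys)" "rev (map inv_edge xs)" us vs]
      by (metis (no_types))
    then show ?thesis by (simp add: r r')
  qed
qed

text \<open>The two squares at \<open>e\<close>, each oriented so as to contain \<open>e\<close>; hence exactly one of them is positive.\<close>

definition neighbours :: "edge \<Rightarrow> plaquette \<Rightarrow> plaquette \<Rightarrow> bool" where
  "neighbours e p q \<longleftrightarrow> lattice_edge e \<and> plaquettes_at e = {p, q} \<and> p \<noteq> q \<and> p \<noteq> plaquette_inv q"

lemma neighbours_commute:
  assumes "neighbours e p q"
  shows "neighbours e q p"
proof -
  have "q \<noteq> plaquette_inv p" using assms unfolding neighbours_def by (metis plaquette_inv_simps(2))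
  then show ?thesis using assms by (auto simp: neighbours_def)
qed

lemma neighbours_inv: "neighbours e p q \<Longrightarrow> neighbours (inv_edge e) (plaquette_inv p) (plaquette_inv q)"
  using neighbours_commute[of e p q] unfolding neighbours_def
  by (auto simp: plaquettes_at_inv plaquette_inv_eq_iff)

lemma neighbours_simps:
  "neighbours ((x, y), (x, y + 1)) (Plaquette (x, y) True) (Plaquette (x - 1, y) False)"
  "neighbours ((x, y), (x + 1, y)) (Plaquette (x, y - 1) True) (Plaquette (x, y) False)"
  by (simp_all add: neighbours_def plaquettes_at_simps lattice_edge_def)

lemma neighbours_shifted:
  "neighbours ((x + 1, y), (x + 1, y + 1)) (Plaquette (x, y) False) (Plaquette (x + 1, y) True)"
  "neighbours ((x, y + 1), (x + 1, y + 1)) (Plaquette (x, y) True) (Plaquette (x, y + 1) False)"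
  using neighbours_commute[OF neighbours_simps(1)[of "x + 1" y]] neighbours_simps(2)[of x "y + 1"] by simp_all

definition undirected_count :: "edge \<Rightarrow> edge list \<Rightarrow> nat" where
  "undirected_count e l = count_list l e + count_list l (inv_edge e)"

lemma undirected_count_inv [simp]: "undirected_count (inv_edge e) l = undirected_count e l"
  by (simp add: undirected_count_def)

lemma undirected_count_append [simp]:
  "undirected_count e (xs @ ys) = undirected_count e xs + undirected_count e ys"
  by (simp add: undirected_count_def)

lemma undirected_count_Nil [simp]: "undirected_count e [] = 0"
  by (simp add: undirected_count_def)

lemma undirected_count_Cons:
  "lattice_edge e \<Longrightarrow> undirected_count e (x # xs) =
    (if x = e \<or> x = inv_edge e then 1 else 0) + undirected_count e xs"
  using inv_edge_neq[of e] by (auto simp: undirected_count_def)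

lemma undirected_count_eq_0: "undirected_count e l = 0 \<longleftrightarrow> e \<notin> set l \<and> inv_edge e \<notin> set l"
  by (simp add: undirected_count_def count_list_0_iff)

lemma undirected_count_rest:
  "p \<in> plaquettes_at e \<Longrightarrow> undirected_count e (plaquette_rest e p) = 0"
  "p \<in> plaquettes_at (inv_edge e) \<Longrightarrow> undirected_count e (plaquette_rest (inv_edge e) p) = 0"
  using plaquette_rest_props[of p e] plaquette_rest_props[of p "inv_edge e"]
  by (simp_all add: undirected_count_eq_0)

lemma undirected_count_rotate [simp]: "undirected_count e (rotate n l) = undirected_count e l"
proof -
  have "count_list (rotate n l) x = count_list l x" for x
    by (metis add.commute append_take_drop_id count_list_append rotate_drop_take)
  then show ?thesis by (simp add: undirected_count_def)
qed

section \<open>Powers of a plaquette\<close>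

definition plaquette_power :: "edge \<Rightarrow> plaquette \<Rightarrow> nat \<Rightarrow> edge list" where
  "plaquette_power e p m = concat (replicate m (e # plaquette_rest e p))"

lemma plaquette_power_simps [simp]:
  "plaquette_power e p 0 = []"
  "plaquette_power e p (Suc m) = e # plaquette_rest e p @ plaquette_power e p m"
  by (simp_all add: plaquette_power_def)

lemma plaquette_power_Suc': "plaquette_power e p (Suc m) = plaquette_power e p m @ e # plaquette_rest e p"
  by (induction m) simp_all

lemma length_plaquette_power: "p \<in> plaquettes_at e \<Longrightarrow> length (plaquette_power e p m) = 4 * m"
  using plaquette_rest_props(5)[of p e] by (induction m) simp_all

lemma walk_plaquette_power:
  "p \<in> plaquettes_at e \<Longrightarrow> lattice_edge e \<Longrightarrow> walk (fst e) (plaquette_power e p m) (fst e)"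
  using plaquette_rest_props(1)[of p e] by (induction m) auto

lemma is_loop_power_Cons:
  assumes "p \<in> plaquettes_at e" "lattice_edge e"
  shows "is_loop (plaquette_power e p m @ e # w) \<longleftrightarrow> walk (snd e) w (fst e)"
proof -
  have "walk u (plaquette_power e p m) (fst e) \<longleftrightarrow> u = fst e" for u
    using walk_plaquette_power[OF assms, of m] by (cases m) auto
  then show ?thesis using assms(2) unfolding is_loop_append by auto
qed

lemma append_eq_append_Cons_notin:
  "xs @ ys = us @ x # vs \<Longrightarrow> x \<notin> set xs \<Longrightarrow> \<exists>us'. us = xs @ us' \<and> ys = us' @ x # vs"
proof (induction xs arbitrary: us)
  case (Cons y xs)
  then show ?case by (cases us) auto
qed simp

text \<open>The copies of \<open>e\<close> in $(es)^m e w$, where $es$ is the plaquette: either one of those that begin a turn,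
  or one in \<open>w\<close>. This enumerates the positive splittings at the first edge.\<close>

lemma power_Cons_split:
  assumes "plaquette_power e p m @ e # w = u @ e # b" and e: "e \<notin> set (plaquette_rest e p)"
  shows "(\<exists>j\<le>m. u = plaquette_power e p j \<and> e # b = plaquette_power e p (m - j) @ e # w) \<or>
    (\<exists>a. w = a @ e # b \<and> u = plaquette_power e p m @ e # a)"
  using assms(1)
proof (induction m arbitrary: u)
  case 0
  then show ?case by (cases u) auto
next
  case (Suc m)
  let ?s = "plaquette_rest e p"
  show ?case
  proof (cases u)
    case Nil
    then show ?thesis using Suc.prems by auto
  next
    case (Cons x u')
    then have "x = e" and eq: "?s @ plaquette_power e p m @ e # w = u' @ e # b" using Suc.prems by auto
    obtain u'' where u': "u' = ?s @ u''" "plaquette_power e p m @ e # w = u'' @ e # b"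
      using append_eq_append_Cons_notin[OF eq e] by blast
    show ?thesis using Suc.IH[OF u'(2)] u'(1) Cons \<open>x = e\<close>
      by (elim disjE exE conjE) (auto intro: exI[of _ "Suc _"])
  qed
qed

lemma power_Cons_split_inv:
  assumes "plaquette_power e p m @ e # w = u @ inv_edge e # b" "inv_edge e \<noteq> e"
    and e: "inv_edge e \<notin> set (plaquette_rest e p)"
  shows "\<exists>a. w = a @ inv_edge e # b \<and> u = plaquette_power e p m @ e # a"
  using assms(1)
proof (induction m arbitrary: u)
  case 0
  then show ?case using assms(2) by (cases u) auto
next
  case (Suc m)
  let ?s = "plaquette_rest e p"
  obtain u' where u: "u = e # u'" and eq: "?s @ plaquette_power e p m @ e # w = u' @ inv_edge e # b"
    using Suc.prems assms(2) by (cases u) auto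
  obtain u'' where u': "u' = ?s @ u''" "plaquette_power e p m @ e # w = u'' @ inv_edge e # b"
    using append_eq_append_Cons_notin[OF eq e] by blast
  show ?case using Suc.IH[OF u'(2)] u'(1) u by auto
qed

section \<open>Plaquette assignments\<close>

definition square_count :: "assignment \<Rightarrow> plaquette \<Rightarrow> nat" where
  "square_count K p = K p + K (plaquette_inv p)"

lemma square_count_inv [simp]: "square_count K (plaquette_inv p) = square_count K p"
  by (simp add: square_count_def)

lemma square_count_False: "square_count K (Plaquette v False) = square_count K (Plaquette v True)"
  using square_count_inv[of K "Plaquette v True"] by simp

lemma decompositionsD:
  assumes "(K1, K2) \<in> decompositions K"
  shows "K1 p + K2 p = K p" "K p = K1 p + K2 p" "square_count K p = square_count K1 p + square_count K2 p"
  using assms by (auto simp: decompositions_def square_count_def) (metis add.assoc add.left_commute)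

lemma finite_assignment_zero [simp]: "finite_assignment (\<lambda>_. 0)"
  by (simp add: finite_assignment_def)

lemma finite_assignment_mono: "finite_assignment K \<Longrightarrow> (\<And>p. K' p \<le> K p) \<Longrightarrow> finite_assignment K'"
  unfolding finite_assignment_def by (erule finite_subset[rotated]) (metis (mono_tags, lifting) Collect_mono le_zero_eq)

lemma area_eq_sum: "finite A \<Longrightarrow> {p. K p \<noteq> 0} \<subseteq> A \<Longrightarrow> area K = (\<Sum>p\<in>A. K p)"
  unfolding area_def by (rule sum.mono_neutral_left) auto

lemma area_mono:
  assumes "finite_assignment K" "\<And>p. K' p \<le> K p"
  shows "area K' \<le> area K"
proof -
  have "{p. K' p \<noteq> 0} \<subseteq> {p. K p \<noteq> 0}" using assms(2) by (metis (mono_tags, lifting) Collect_mono le_zero_eq)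
  then have "area K' = (\<Sum>p | K p \<noteq> 0. K' p)"
    using assms(1) by (intro area_eq_sum) (auto simp: finite_assignment_def)
  then show ?thesis unfolding area_def using assms(2) by (simp add: sum_mono)
qed

lemma decompositions_finite_area:
  assumes "(K1, K2) \<in> decompositions K" "finite_assignment K"
  shows "finite_assignment K1" "finite_assignment K2" "area K1 \<le> area K" "area K2 \<le> area K"
  using assms(2) finite_assignment_mono[of K] area_mono[of K] decompositionsD(2)[OF assms(1)]
  by simp_all

lemma finite_decompositions:
  assumes "finite_assignment K"
  shows "finite (decompositions K)"
proof -
  let ?S = "{p. K p \<noteq> 0}"
  let ?F = "{f. (\<forall>p. (p \<in> ?S \<longrightarrow> f p \<in> {..area K}) \<and> (p \<notin> ?S \<longrightarrow> f p = 0))}"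
  have S: "finite ?S" using assms by (simp add: finite_assignment_def)
  have F: "finite ?F" using S by (intro finite_set_of_finite_funs) auto
  have K: "K p \<le> area K" for p
  proof (cases "K p = 0")
    case False
    then show ?thesis unfolding area_def using S by (intro member_le_sum) auto
  qed simp
  have "decompositions K \<subseteq> ?F \<times> ?F"
  proof (rule subrelI)
    fix K1 K2 assume "(K1, K2) \<in> decompositions K"
    note d = decompositionsD(2)[OF this]
    have "K1 p \<le> area K \<and> K2 p \<le> area K \<and> (K p = 0 \<longrightarrow> K1 p = 0 \<and> K2 p = 0)" for p
      using K[of p] d[of p] by simp
    then show "(K1, K2) \<in> ?F \<times> ?F" by simp
  qed
  then show ?thesis using F by (meson finite_SigmaI finite_subset)
qed

lemma remove_plaquette_finite: "finite_assignment K \<Longrightarrow> finite_assignment (remove_plaquette K p)"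
  by (erule finite_assignment_mono) (simp add: remove_plaquette_def)

lemma area_remove_plaquette:
  assumes "finite_assignment K" "K p \<ge> 1"
  shows "Suc (area (remove_plaquette K p)) = area K"
proof -
  let ?S = "{p. K p \<noteq> 0}"
  have S: "finite ?S" "p \<in> ?S" using assms by (auto simp: finite_assignment_def)
  have "area (remove_plaquette K p) = (\<Sum>q\<in>?S. remove_plaquette K p q)"
    using S by (intro area_eq_sum) (auto simp: remove_plaquette_def split: if_splits)
  also have "\<dots> = (K p - 1) + (\<Sum>q\<in>?S - {p}. K q)"
    using S by (subst sum.remove[of _ p]) (auto simp: remove_plaquette_def)
  finally show ?thesis unfolding area_def using S assms(2) by (subst sum.remove[of _ p]) auto
qed

lemma square_count_remove:
  assumes "K p \<ge> 1"
  shows "square_count K q = square_count (remove_plaquette K p) q +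
    (if q = p \<or> q = plaquette_inv p then 1 else 0)"
  using assms by (auto simp: square_count_def remove_plaquette_def)

definition single :: "plaquette \<Rightarrow> assignment" where
  "single p = (\<lambda>_. 0)(p := 1)"

lemma finite_square_count_support: "finite_assignment K \<Longrightarrow> finite {p. square_count K p \<noteq> 0}"
proof -
  assume "finite_assignment K"
  then have f: "finite {p. K p \<noteq> 0}" by (simp add: finite_assignment_def)
  have "{p. square_count K p \<noteq> 0} \<subseteq> {p. K p \<noteq> 0} \<union> plaquette_inv ` {p. K p \<noteq> 0}"
  proof
    fix p assume "p \<in> {p. square_count K p \<noteq> 0}"
    then have "K p \<noteq> 0 \<or> K (plaquette_inv p) \<noteq> 0" by (simp add: square_count_def)
    moreover have "p = plaquette_inv (plaquette_inv p)" by simp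
    ultimately show "p \<in> {p. K p \<noteq> 0} \<union> plaquette_inv ` {p. K p \<noteq> 0}" by blast
  qed
  then show ?thesis using f by (meson finite_UnI finite_imageI finite_subset)
qed

text \<open>An infinite path of distinct squares leaves the support of a finite assignment.\<close>

lemma square_count_escapes:
  fixes r :: "nat \<Rightarrow> plaquette"
  assumes "finite_assignment K" "inj r"
  obtains n where "square_count K (r n) = 0"
proof -
  have "\<not> range r \<subseteq> {p. square_count K p \<noteq> 0}"
    using finite_square_count_support[OF assms(1)] range_inj_infinite[OF assms(2)] finite_subset by blast
  then show ?thesis using that by blast
qed

lemma escape_zero:
  fixes r :: "nat \<Rightarrow> plaquette"
  assumes "finite_assignment K" "inj r" and step: "\<And>i. square_count K (r i) \<le> square_count K (r (Suc i))"
  shows "square_count K (r 0) = 0"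
proof -
  obtain n where "square_count K (r n) = 0" using square_count_escapes[OF assms(1,2)] .
  moreover have "square_count K (r 0) \<le> square_count K (r n)" for n
  proof (induction n)
    case (Suc n)
    then show ?case using step[of n] by linarith
  qed simp
  ultimately show ?thesis by (metis le_zero_eq)
qed

abbreviation square_at :: "int \<Rightarrow> int \<Rightarrow> plaquette" where
  "square_at x y \<equiv> Plaquette (x, y) True"

lemma escape_zero_right:
  "finite_assignment K \<Longrightarrow> (\<And>i::nat. square_count K (square_at (x + int i) y) \<le> square_count K (square_at (x + int i + 1) y)) \<Longrightarrow> square_count K (square_at x y) = 0"
  using escape_zero[of K "\<lambda>i. square_at (x + int i) y"] by (simp add: inj_def ac_simps)

lemma escape_zero_left:
  "finite_assignment K \<Longrightarrow> (\<And>i::nat. square_count K (square_at (x - int i) y) \<le> square_count K (square_at (x - int i - 1) y)) \<Longrightarrow> square_count K (square_at x y) = 0"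
  using escape_zero[of K "\<lambda>i. square_at (x - int i) y"] by (simp add: inj_def diff_diff_eq ac_simps)

lemma escape_zero_up:
  "finite_assignment K \<Longrightarrow> (\<And>i::nat. square_count K (square_at x (y + int i)) \<le> square_count K (square_at x (y + int i + 1))) \<Longrightarrow> square_count K (square_at x y) = 0"
  using escape_zero[of K "\<lambda>i. square_at x (y + int i)"] by (simp add: inj_def ac_simps)

lemma escape_zero_down:
  "finite_assignment K \<Longrightarrow> (\<And>i::nat. square_count K (square_at x (y - int i)) \<le> square_count K (square_at x (y - int i - 1))) \<Longrightarrow> square_count K (square_at x y) = 0"
  using escape_zero[of K "\<lambda>i. square_at x (y - int i)"] by (simp add: inj_def diff_diff_eq ac_simps)

lemma balanced_neighbours:
  assumes "balanced l K" "neighbours e p q"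
  shows "count_list l e + K p + K q = count_list l (inv_edge e) + K (plaquette_inv p) + K (plaquette_inv q)"
proof -
  have "p \<noteq> q" "plaquette_inv p \<noteq> plaquette_inv q" "lattice_edge e" "plaquettes_at e = {p, q}"
    using assms(2) by (auto simp: neighbours_def plaquette_inv_eq_iff)
  moreover have "edge_count e l K = edge_count (inv_edge e) l K"
    using assms(1) \<open>lattice_edge e\<close> unfolding balanced_def by blast
  ultimately show ?thesis by (simp add: edge_count_def plaquettes_at_inv)
qed

text \<open>For an edge on the rim of the loop: outside (at \<open>r\<close>) there are no plaquettes and the loop uses the
  edge in one direction only. Balance then makes the difference of \<open>K p\<close> and its counterpart as large, in
  absolute value, as the bound for their sum.\<close>

lemma outer_one_sided:
  assumes "balanced l K" "neighbours f p r" "square_count K r = 0" "f \<in> set l \<longleftrightarrow> inv_edge f \<notin> set l"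
    and "square_count K p \<le> square_count K r + undirected_count f l"
  shows "K p = 0 \<or> K (plaquette_inv p) = 0"
proof -
  have "count_list l f = 0 \<or> count_list l (inv_edge f) = 0" using assms(4) by (auto simp: count_list_0_iff)
  moreover have "K r = 0" "K (plaquette_inv r) = 0" using assms(3) by (simp_all add: square_count_def)
  ultimately show ?thesis
    using balanced_neighbours[OF assms(1,2)] assms(3,5) by (auto simp: square_count_def undirected_count_def)
qed

lemma one_sided_balance:
  assumes "balanced l K" "neighbours e p q" "e \<notin> set l" "inv_edge e \<notin> set l"
    and "K p = 0 \<or> K (plaquette_inv p) = 0" "K q = 0 \<or> K (plaquette_inv q) = 0"
  shows "square_count K p = square_count K q"
  using balanced_neighbours[OF assms(1,2)] assms(3-6) by (auto simp: square_count_def count_list_0_iff)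

text \<open>From any square other than \<open>p\<close> there is a straight ray that does not meet the boundary of \<open>p\<close>.\<close>

lemma support_of_plaquette_loop:
  assumes lip: "\<And>e q r. neighbours e q r \<Longrightarrow> square_count K q \<le> square_count K r + undirected_count e l"
    and fin: "finite_assignment K" and l: "set l \<subseteq> set (plaquette_loop p)" and r: "corner r \<noteq> corner p"
  shows "square_count K r = 0"
proof -
  obtain x y s where p: "p = Plaquette (x, y) s" by (metis plaquette.exhaust surj_pair)
  obtain a b t where r': "r = Plaquette (a, b) t" by (metis plaquette.exhaust surj_pair)
  have sr: "square_count K r = square_count K (square_at a b)"
    by (cases t) (simp_all add: r' square_count_False)
  have out1: "undirected_count ((u, v), (u, v + 1)) l = 0" if "u < x \<or> u > x + 1 \<or> v \<noteq> y" for u v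
    using l that edge_of_square_iff(1,2)[of u v x y s] by (auto simp: undirected_count_eq_0 p split: if_splits)
  have out2: "undirected_count ((u, v), (u + 1, v)) l = 0" if "v < y \<or> v > y + 1 \<or> u \<noteq> x" for u v
    using l that edge_of_square_iff(3,4)[of u v x y s] by (auto simp: undirected_count_eq_0 p split: if_splits)
  have h1: "square_count K (square_at u v) \<le> square_count K (square_at (u - 1) v) + undirected_count ((u, v), (u, v + 1)) l" for u v
    using lip[OF neighbours_simps(1)[of u v]] by (simp add: square_count_False)
  have h2: "square_count K (square_at (u - 1) v) \<le> square_count K (square_at u v) + undirected_count ((u, v), (u, v + 1)) l" for u v
    using lip[OF neighbours_commute[OF neighbours_simps(1)[of u v]]] by (simp add: square_count_False)
  have v1: "square_count K (square_at u (v - 1)) \<le> square_count K (square_at u v) + undirected_count ((u, v), (u + 1, v)) l" for u v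
    using lip[OF neighbours_simps(2)[of u v]] by (simp add: square_count_False)
  have v2: "square_count K (square_at u v) \<le> square_count K (square_at u (v - 1)) + undirected_count ((u, v), (u + 1, v)) l" for u v
    using lip[OF neighbours_commute[OF neighbours_simps(2)[of u v]]] by (simp add: square_count_False)
  have "a > x \<or> a < x \<or> a = x \<and> b > y \<or> a = x \<and> b < y" using r by (auto simp: p r')
  then have "square_count K (square_at a b) = 0"
  proof (elim disjE conjE)
    assume "a > x"
    then show ?thesis
    proof (intro escape_zero_right[OF fin])
      fix i :: nat
      show "square_count K (square_at (a + int i) b) \<le> square_count K (square_at (a + int i + 1) b)"
        using h2[of "a + int i + 1" b] out1[of "a + int i + 1" b] \<open>a > x\<close> by simp
    qed
  next
    assume "a < x"
    then show ?thesis
    proof (intro escape_zero_left[OF fin])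
      fix i :: nat
      show "square_count K (square_at (a - int i) b) \<le> square_count K (square_at (a - int i - 1) b)"
        using h1[of "a - int i" b] out1[of "a - int i" b] \<open>a < x\<close> by simp
    qed
  next
    assume "b > y"
    then show ?thesis
    proof (intro escape_zero_up[OF fin])
      fix i :: nat
      show "square_count K (square_at a (b + int i)) \<le> square_count K (square_at a (b + int i + 1))"
        using v1[of a "b + int i + 1"] out2[of "b + int i + 1" a] \<open>b > y\<close> by simp
    qed
  next
    assume "b < y"
    then show ?thesis
    proof (intro escape_zero_down[OF fin])
      fix i :: nat
      show "square_count K (square_at a (b - int i)) \<le> square_count K (square_at a (b - int i - 1))"
        using v2[of a "b - int i"] out2[of "b - int i" a] \<open>b < y\<close> by simp
    qed
  qed
  then show ?thesis by (simp add: sr)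
qed

section \<open>The master loop equation\<close>

lemma sum_positions_Cons:
  "(\<Sum>i | i < length (y # w) \<and> (y # w) ! i = x. f i) =
    (if y = x then f 0 else 0) + (\<Sum>i | i < length w \<and> w ! i = x. f (Suc i) :: real)"
proof -
  have *: "{i. i < length (y # w) \<and> (y # w) ! i = x} =
      (if y = x then {0} else {}) \<union> Suc ` {i. i < length w \<and> w ! i = x}"
    by (auto simp: image_iff less_Suc_eq_0_disj)
  show ?thesis unfolding * by (subst sum.union_disjoint) (auto simp: sum.reindex)
qed

lemma sum_positions_snoc:
  "(\<Sum>i | i < length (w @ [y]) \<and> (w @ [y]) ! i = x. f i) =
    (\<Sum>i | i < length w \<and> w ! i = x. f i) + (if y = x then f (length w) else 0 :: real)"
proof -
  have *: "{i. i < length (w @ [y]) \<and> (w @ [y]) ! i = x} =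
      {i. i < length w \<and> w ! i = x} \<union> (if y = x then {length w} else {})"
    by (auto simp: nth_append less_Suc_eq)
  show ?thesis unfolding * by (subst sum.union_disjoint) auto
qed

lemma sum_pair:
  assumes "a \<noteq> b"
  shows "(\<Sum>p | p \<in> {a, b} \<and> P p. f p) = (if P a then f a else 0) + (if P b then f b else 0 :: real)"
proof -
  have "{p. p \<in> {a, b} \<and> P p} = (if P a then {a} else {}) \<union> (if P b then {b} else {})" by auto
  then show ?thesis using assms by simp
qed

locale surface_sum =
  fixes c :: "edge list \<Rightarrow> assignment \<Rightarrow> real"
  assumes coeffs: "surface_coefficients c"
begin

lemma c_rotate:
  assumes "is_loop l" "finite_assignment K"
  shows "c (rotate n l) K = c l K"
  using coeffs[unfolded surface_coefficients_def, THEN conjunct1] assms by blast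

lemma c_commute:
  assumes "is_loop (xs @ ys)" "finite_assignment K"
  shows "c (xs @ ys) K = c (ys @ xs) K"
  using coeffs assms unfolding surface_coefficients_def by (metis rotate_append)

lemma c_rotate1:
  assumes "is_loop (e # w)" "finite_assignment K"
  shows "c (w @ [e]) K = c (e # w) K"
  using c_commute[of "[e]" w K] assms by simp

lemma balanced_if_nonzero: "is_loop l \<Longrightarrow> finite_assignment K \<Longrightarrow> c l K \<noteq> 0 \<Longrightarrow> balanced l K"
  using coeffs unfolding surface_coefficients_def by blast

lemma c_Nil: "finite_assignment K \<Longrightarrow> c [] K = (if K = (\<lambda>_. 0) then 1 else 0)"
  using coeffs unfolding surface_coefficients_def by auto

text \<open>What a splitting into the loops \<open>a\<close> and \<open>b\<close> contributes to the master loop equation.\<close>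

definition convolution :: "edge list \<Rightarrow> edge list \<Rightarrow> assignment \<Rightarrow> real" where
  "convolution a b K = (\<Sum>(K1, K2)\<in>decompositions K. c a K1 * c b K2)"

lemma convolution_cong:
  assumes "finite_assignment K"
    and "\<And>K1. finite_assignment K1 \<Longrightarrow> area K1 \<le> area K \<Longrightarrow> c a K1 = c a' K1"
    and "\<And>K1. finite_assignment K1 \<Longrightarrow> area K1 \<le> area K \<Longrightarrow> c b K1 = c b' K1"
  shows "convolution a b K = convolution a' b' K"
  unfolding convolution_def
proof (rule sum.cong[OF refl], clarify)
  fix K1 K2 assume "(K1, K2) \<in> decompositions K"
  note decompositions_finite_area[OF this assms(1)]
  then show "c a K1 * c b K2 = c a' K1 * c b' K2" using assms(2,3) by simp
qed

lemma convolution_commute: "convolution a b K = convolution b a K"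
proof -
  have "convolution a b K = (\<Sum>x\<in>prod.swap ` decompositions K. case x of (K1, K2) \<Rightarrow> c b K1 * c a K2)"
    unfolding convolution_def by (subst sum.reindex) (auto simp: case_prod_beta mult.commute)
  moreover have "prod.swap ` decompositions K = decompositions K"
    by (force simp: decompositions_def add.commute)
  ultimately show ?thesis by (simp add: convolution_def)
qed

lemma convolution_eq_0:
  assumes "finite_assignment K"
    and "\<And>K1 K2. \<lbrakk>(K1, K2) \<in> decompositions K; finite_assignment K1; finite_assignment K2;
      area K1 \<le> area K; area K2 \<le> area K; c a K1 \<noteq> 0; c b K2 \<noteq> 0\<rbrakk> \<Longrightarrow> False"
  shows "convolution a b K = 0"
  unfolding convolution_def
proof (rule sum.neutral, clarify)
  fix K1 K2 assume d: "(K1, K2) \<in> decompositions K"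
  show "c a K1 * c b K2 = 0"
    using assms(2)[OF d decompositions_finite_area[OF d assms(1)]] by auto
qed

text \<open>A coefficient function of \<open>b\<close> that is a point mass turns the convolution into a shift.\<close>

lemma convolution_unit:
  assumes "finite_assignment K"
    and b: "\<And>K2. finite_assignment K2 \<Longrightarrow> area K2 \<le> area K \<Longrightarrow> c b K2 = (if K2 = K0 then 1 else 0)"
  shows "convolution a b K = (if \<forall>p. K0 p \<le> K p then c a (\<lambda>p. K p - K0 p) else 0)"
proof -
  have "convolution a b K = (\<Sum>x\<in>decompositions K. if x = ((\<lambda>p. K p - K0 p), K0) then c a (\<lambda>p. K p - K0 p) else 0)"
    unfolding convolution_def
  proof (rule sum.cong[OF refl], clarify)
    fix K1 K2 assume d: "(K1, K2) \<in> decompositions K"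
    have "K1 = (\<lambda>p. K p - K2 p)" using decompositionsD(2)[OF d] by auto
    then show "c a K1 * c b K2 = (if (K1, K2) = ((\<lambda>p. K p - K0 p), K0) then c a (\<lambda>p. K p - K0 p) else 0)"
      using b decompositions_finite_area[OF d assms(1)] by auto
  qed
  also have "\<dots> = (if ((\<lambda>p. K p - K0 p), K0) \<in> decompositions K then c a (\<lambda>p. K p - K0 p) else 0)"
    using finite_decompositions[OF assms(1)] by (simp add: sum.delta)
  also have "((\<lambda>p. K p - K0 p), K0) \<in> decompositions K \<longleftrightarrow> (\<forall>p. K0 p \<le> K p)"
    unfolding decompositions_def by (auto, metis le_add2)
  finally show ?thesis .
qed

lemma convolution_Nil: "finite_assignment K \<Longrightarrow> convolution a [] K = c a K"
  using convolution_unit[of K "[]" "\<lambda>_. 0" a] c_Nil by simp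

lemma convolution_single:
  assumes "finite_assignment K"
    and "\<And>K2. finite_assignment K2 \<Longrightarrow> area K2 \<le> area K \<Longrightarrow> c b K2 = (if K2 = single p then 1 else 0)"
  shows "convolution a b K = (if K p \<ge> 1 then c a (remove_plaquette K p) else 0)"
proof -
  have "(\<forall>q. single p q \<le> K q) \<longleftrightarrow> K p \<ge> 1" by (auto simp: single_def)
  moreover have "(\<lambda>q. K q - single p q) = remove_plaquette K p"
    by (auto simp: single_def remove_plaquette_def)
  ultimately show ?thesis using convolution_unit[OF assms] by simp
qed

text \<open>The equation at the first edge of the loop. By invariance under rotation this covers all positions. The
  second loop of a positive splitting is rotated so that it also begins with \<open>e\<close>.\<close>

lemma master:
  assumes "is_loop (e # w)" "finite_assignment K"
  shows "c (e # w) K =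
      (\<Sum>i | i < length w \<and> w ! i = inv_edge e. convolution (drop (Suc i) w) (take i w) K)
    - (\<Sum>i | i < length w \<and> w ! i = e. convolution (e # drop (Suc i) w) (e # take i w) K)
    + (\<Sum>p | p \<in> plaquettes_at (inv_edge e) \<and> K p \<ge> 1.
        c (plaquette_rest (inv_edge e) p @ w) (remove_plaquette K p))
    - (\<Sum>q | q \<in> plaquettes_at e \<and> K q \<ge> 1.
        c (e # plaquette_rest e q @ e # w) (remove_plaquette K q))"
proof -
  have m: "master_loop_equation c (e # w) K 0"
    using coeffs assms unfolding surface_coefficients_def by simp
  have idx: "{j. 0 < j \<and> j < length (e # w) \<and> rotate 0 (e # w) ! j = x} = Suc ` {i. i < length w \<and> w ! i = x}" for x
    by (auto simp: image_iff gr0_conv_Suc)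
  have neg: "(\<Sum>j\<in>neg_positions 0 (e # w). split_term c (neg_split 0 (e # w) j) K) =
      (\<Sum>i | i < length w \<and> w ! i = inv_edge e. convolution (drop (Suc i) w) (take i w) K)"
    unfolding neg_positions_def idx
    by (subst sum.reindex) (auto simp: split_term_def neg_split_def convolution_def)
  have loop: "is_loop (e # take i w)" if "i < length w" "w ! i = e" for i
  proof -
    have "walk (snd e) (take i w @ e # drop (Suc i) w) (fst e)"
      using assms(1) id_take_nth_drop[OF that(1)] that(2) by simp
    then show ?thesis using assms(1) by simp
  qed
  have "(\<Sum>j\<in>pos_positions 0 (e # w). split_term c (pos_split 0 (e # w) j) K) =
      (\<Sum>i | i < length w \<and> w ! i = e. convolution (e # drop (Suc i) w) (take i w @ [e]) K)"
    unfolding pos_positions_def idx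
    by (subst sum.reindex) (auto simp: split_term_def pos_split_def convolution_def)
  also have "\<dots> = (\<Sum>i | i < length w \<and> w ! i = e. convolution (e # drop (Suc i) w) (e # take i w) K)"
    by (intro sum.cong convolution_cong assms(2) refl c_rotate1 loop) auto
  finally have pos: "(\<Sum>j\<in>pos_positions 0 (e # w). split_term c (pos_split 0 (e # w) j) K) = \<dots>" .
  show ?thesis
    using m unfolding master_loop_equation_def neg pos
    by (simp add: neg_deform_def pos_deform_def Let_def)
qed

section \<open>Removal of backtracks\<close>

text \<open>Add the master loop equations of the loop $e e^{-1} w$ at $e$ and at $e^{-1}$. In each of them the splitting
  at the other edge of the backtrack gives \<open>c w K\<close>. Every other term of one equation occurs in the other
  with the opposite sign, once the backtracks that it contains are removed by induction. So twice
  the coefficient is \<open>2 * c w K\<close>.\<close>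

lemma c_backtrack:
  assumes "is_loop (e # inv_edge e # w)" "finite_assignment K"
  shows "c (e # inv_edge e # w) K = c w K"
  using assms
proof (induction "5 * area K + length w" arbitrary: e w K rule: less_induct)
  case less
  have le: "lattice_edge e" and w: "walk (fst e) w (fst e)" and ne: "inv_edge e \<noteq> e"
    using less.prems(1) inv_edge_neq by auto
  note fin = less.prems(2)
  have IH: "c (e # inv_edge e # w') K' = c w' K'"
    if "walk (fst e) w' (fst e)" "finite_assignment K'" "5 * area K' + length w' < 5 * area K + length w" for w' K'
    using less.hyps[of K' w' e] that le by simp
  note ws = walk_split[OF w]
  \<comment> \<open>removal of the backtrack from the second part of each splitting at a copy of \<open>e\<close>\<close>
  have pos: "convolution (e # drop (Suc i) w) (e # inv_edge e # take i w) K = convolution (drop (Suc i) w @ [e]) (take i w) K"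
    if i: "i < length w" "w ! i = e" for i
    using fin ws[OF i] le i by (intro convolution_cong IH c_rotate1[symmetric]) auto
  \<comment> \<open>the same for the copies of $e^{-1}$ in the second equation\<close>
  have neg: "convolution (inv_edge e # drop (Suc i) w @ [e]) (inv_edge e # take i w) K = convolution (drop (Suc i) w) (inv_edge e # take i w) K"
    if i: "i < length w" "w ! i = inv_edge e" for i
  proof (intro convolution_cong fin refl)
    fix K1 assume K1: "finite_assignment K1" "area K1 \<le> area K"
    have "c ((inv_edge e # drop (Suc i) w) @ [e]) K1 = c (e # inv_edge e # drop (Suc i) w) K1"
      using ws[OF i] le K1 by (intro c_rotate1) auto
    also have "\<dots> = c (drop (Suc i) w) K1"
      using ws[OF i] le K1 i by (intro IH) auto
    finally show "c (inv_edge e # drop (Suc i) w @ [e]) K1 = c (drop (Suc i) w) K1" by simp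
  qed
  have defp: "c (e # plaquette_rest e q @ e # inv_edge e # w) (remove_plaquette K q) =
      c (plaquette_rest e q @ w @ [e]) (remove_plaquette K q)" (is "c _ ?K = _")
    if q: "q \<in> plaquettes_at e" "K q \<ge> 1" for q
  proof -
    let ?s = "plaquette_rest e q"
    note s = plaquette_rest_props[OF q(1)]
    have K': "finite_assignment ?K" "Suc (area ?K) = area K"
      using fin q(2) by (simp_all add: remove_plaquette_finite area_remove_plaquette)
    have "c ((e # ?s) @ (e # inv_edge e # w)) ?K = c ((e # inv_edge e # w) @ (e # ?s)) ?K"
      using s(1) le w K' by (intro c_commute) auto
    also have "\<dots> = c (w @ (e # ?s)) ?K"
      using IH[of "w @ e # ?s" ?K] s(1,5) le w K' by auto
    also have "\<dots> = c ((e # ?s) @ w) ?K"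
      using s(1) le w K' by (intro c_commute) (auto simp: is_loop_append)
    also have "\<dots> = c ((?s @ w) @ [e]) ?K"
      using s(1) le w K' by (subst c_rotate1) auto
    finally show ?thesis by simp
  qed
  have defn: "c (inv_edge e # plaquette_rest (inv_edge e) q @ inv_edge e # w @ [e]) (remove_plaquette K q) =
      c (plaquette_rest (inv_edge e) q @ inv_edge e # w) (remove_plaquette K q)" (is "c _ ?K = _")
    if q: "q \<in> plaquettes_at (inv_edge e)" "K q \<ge> 1" for q
  proof -
    let ?s = "plaquette_rest (inv_edge e) q"
    note s = plaquette_rest_props[OF q(1)]
    have K': "finite_assignment ?K" "Suc (area ?K) = area K"
      using fin q(2) by (simp_all add: remove_plaquette_finite area_remove_plaquette)
    have "c ((inv_edge e # ?s @ inv_edge e # w) @ [e]) ?K = c (e # inv_edge e # ?s @ inv_edge e # w) ?K"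
      using s(1) le w K' by (intro c_rotate1) auto
    also have "\<dots> = c (?s @ inv_edge e # w) ?K"
      using IH[of "?s @ inv_edge e # w" ?K] s(1,5) le w K' by auto
    finally show ?thesis by simp
  qed
  have eq1: "c (e # inv_edge e # w) K = c w K
      + (\<Sum>i | i < length w \<and> w ! i = inv_edge e. convolution (drop (Suc i) w) (inv_edge e # take i w) K)
      - (\<Sum>i | i < length w \<and> w ! i = e. convolution (drop (Suc i) w @ [e]) (take i w) K)
      + (\<Sum>p | p \<in> plaquettes_at (inv_edge e) \<and> K p \<ge> 1.
          c (plaquette_rest (inv_edge e) p @ inv_edge e # w) (remove_plaquette K p))
      - (\<Sum>q | q \<in> plaquettes_at e \<and> K q \<ge> 1.
          c (plaquette_rest e q @ w @ [e]) (remove_plaquette K q))"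
    using ne fin by (simp add: master[OF less.prems] sum_positions_Cons[simplified] convolution_Nil pos defp cong: conj_cong)
  have loop2: "is_loop (inv_edge e # w @ [e])" using le w by auto
  have "c (inv_edge e # w @ [e]) K = c w K
      - (\<Sum>i | i < length w \<and> w ! i = inv_edge e. convolution (drop (Suc i) w) (inv_edge e # take i w) K)
      + (\<Sum>i | i < length w \<and> w ! i = e. convolution (drop (Suc i) w @ [e]) (take i w) K)
      - (\<Sum>p | p \<in> plaquettes_at (inv_edge e) \<and> K p \<ge> 1.
          c (plaquette_rest (inv_edge e) p @ inv_edge e # w) (remove_plaquette K p))
      + (\<Sum>q | q \<in> plaquettes_at e \<and> K q \<ge> 1.
          c (plaquette_rest e q @ w @ [e]) (remove_plaquette K q))"
    using ne fin by (simp add: master[OF loop2 fin] sum_positions_snoc[simplified] convolution_commute[of "[]"] convolution_Nil neg defn cong: conj_cong)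
  moreover have "c (inv_edge e # w @ [e]) K = c (e # inv_edge e # w) K"
    using c_rotate1[OF less.prems] by simp
  ultimately show ?case using eq1 by simp
qed

lemma c_remove_backtrack:
  assumes "is_loop (xs @ e # inv_edge e # ys)" "finite_assignment K"
  shows "c (xs @ e # inv_edge e # ys) K = c (xs @ ys) K"
proof -
  have l: "is_loop ((e # inv_edge e # ys) @ xs)" using assms(1) is_loop_commute by blast
  have "c (xs @ e # inv_edge e # ys) K = c (e # inv_edge e # ys @ xs) K"
    using c_commute[OF assms] by simp
  also have "\<dots> = c (ys @ xs) K" using c_backtrack[of e "ys @ xs"] l assms(2) by simp
  also have "\<dots> = c (xs @ ys) K" using l assms(2) by (intro c_commute) (auto simp: is_loop_append)
  finally show ?thesis .
qed

lemma c_cancel_path: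
  assumes "is_loop (rev (map inv_edge s) @ s @ w)" "finite_assignment K"
  shows "c (rev (map inv_edge s) @ s @ w) K = c w K"
  using assms(1)
proof (induction s)
  case (Cons x s)
  have l: "is_loop (rev (map inv_edge s) @ inv_edge x # inv_edge (inv_edge x) # s @ w)"
    using Cons.prems by simp
  have "is_loop (rev (map inv_edge s) @ s @ w)"
    using Cons.prems by (auto simp: is_loop_append)
  then show ?case using c_remove_backtrack[OF l assms(2)] Cons.IH by simp
qed simp

lemma c_removes_backtrack:
  assumes "is_loop l" "finite_assignment K" "removes_backtrack l l'"
  shows "is_loop l'" "c l K = c l' K" "length l = length l' + 2" "undirected_count e l' \<le> undirected_count e l"
proof -
  obtain n x where r: "rotate n l = x # inv_edge x # l'" using assms(3) unfolding removes_backtrack_def by blast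
  have loop: "is_loop (x # inv_edge x # l')" using assms(1) is_loop_rotate[of n l] r by simp
  then show "is_loop l'" by (auto simp: is_loop_iff_walk)
  show "c l K = c l' K" using c_rotate[OF assms(1,2), of n] c_backtrack[OF loop assms(2)] r by simp
  show "length l = length l' + 2" using arg_cong[OF r, of length] by simp
  have "undirected_count e l = undirected_count e (x # inv_edge x # l')" using r undirected_count_rotate[of e n l] by simp
  then show "undirected_count e l' \<le> undirected_count e l" by (simp add: undirected_count_def)
qed

lemma c_remove_backtracks:
  assumes "is_loop l"
  shows "is_loop (remove_backtracks l) \<and> (\<forall>K. finite_assignment K \<longrightarrow> c l K = c (remove_backtracks l) K)"
  using remove_backtracks_reaches[of l]
proof (induction rule: rtranclp_induct)
  case (step l1 l2)
  then show ?case using c_removes_backtrack[of l1 _ l2] finite_assignment_zero by metis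
qed (use assms in simp)

section \<open>The Lipschitz bound\<close>

text \<open>The three claims are proved by simultaneous induction on \<open>5 * area K + length l\<close>. The factor 5 is due to
  deformations, which remove one plaquette and lengthen the loop by at most four edges; splittings
  shorten the loop and do not increase the area.\<close>

definition excess_claim :: "nat \<Rightarrow> bool" where
  "excess_claim n \<longleftrightarrow> (\<forall>e p q m w K. neighbours e p q \<longrightarrow> is_loop (plaquette_power e p m @ e # w) \<longrightarrow>
     finite_assignment K \<longrightarrow> 5 * area K + length (plaquette_power e p m @ e # w) = n \<longrightarrow>
     c (plaquette_power e p m @ e # w) K \<noteq> 0 \<longrightarrow>
     int (square_count K p) \<le> int (square_count K q) + int (undirected_count e w) + 1 - int m)"

definition lipschitz_claim :: "nat \<Rightarrow> bool" where
  "lipschitz_claim n \<longleftrightarrow> (\<forall>e p q l K. neighbours e p q \<longrightarrow> is_loop l \<longrightarrow>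
     finite_assignment K \<longrightarrow> 5 * area K + length l = n \<longrightarrow> c l K \<noteq> 0 \<longrightarrow>
     square_count K p \<le> square_count K q + undirected_count e l)"

definition power_claim :: "nat \<Rightarrow> bool" where
  "power_claim n \<longleftrightarrow> (\<forall>e p q j K. neighbours e p q \<longrightarrow> finite_assignment K \<longrightarrow>
     5 * area K + 4 * Suc j = n \<longrightarrow>
     c (plaquette_power e p (Suc j)) K = (if j = 0 \<and> K = single (plaquette_inv p) then 1 else 0))"

text \<open>Suppose that the bound fails for the loop $(es)^m e w$, where $es$ is the plaquette \<open>p\<close>, and expand at its
  first edge. In each splitting at a copy of \<open>e\<close> or $e^{-1}$ in \<open>w\<close>, the bounds of the two
  parts add up to at most the bound for the whole, so one of them fails as well. Splitting off
  $j \geq 2$ turns gives zero by the claim on powers. If \<open>m \<ge> 1\<close>, the splitting at \<open>j = 1\<close> and the negative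
  deformation by \<open>p\<close> both contribute, with opposite signs, the coefficient of $(es)^{m-1} e w$ with one plaquette removed. In the remaining deformations the bound still fails.\<close>

lemma excess_step:
  assumes IH: "\<And>k. k < n \<Longrightarrow> excess_claim k \<and> lipschitz_claim k \<and> power_claim k"
  shows "excess_claim n"
  unfolding excess_claim_def
proof (intro allI impI, rule ccontr)
  fix e p q m w K
  let ?P = "plaquette_power e p" and ?s = "plaquette_rest e p" and ?p = "plaquette_inv p" and ?q = "plaquette_inv q"
  let ?sc = "\<lambda>K p. int (square_count K p)" and ?n = "\<lambda>w. int (undirected_count e w)"
  assume nb: "neighbours e p q" and loop: "is_loop (?P m @ e # w)" and fin: "finite_assignment K"
    and n: "5 * area K + length (?P m @ e # w) = n" and nz: "c (?P m @ e # w) K \<noteq> 0"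
    and "\<not> ?sc K p \<le> ?sc K q + ?n w + 1 - int m"
  then have bad: "?sc K p > ?sc K q + ?n w + 1 - int m" by simp
  have le: "lattice_edge e" and at: "plaquettes_at e = {p, q}" and pq: "p \<noteq> q" "p \<noteq> ?q" "q \<noteq> ?p"
    using nb neighbours_commute[OF nb] by (auto simp: neighbours_def)
  have ne: "inv_edge e \<noteq> e" using inv_edge_neq[OF le] .
  have pe: "p \<in> plaquettes_at e" and qe: "q \<in> plaquettes_at e" using at by auto
  have ati: "plaquettes_at (inv_edge e) = {?p, ?q}" by (simp add: plaquettes_at_inv at)
  then have pe': "?p \<in> plaquettes_at (inv_edge e)" and qe': "?q \<in> plaquettes_at (inv_edge e)" by auto
  note s = plaquette_rest_props[OF pe]
  note len = length_plaquette_power[OF pe]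
  note lp = is_loop_power_Cons[OF pe le]
  note wp = walk_plaquette_power[OF pe le]
  have w: "walk (snd e) w (fst e)" using loop lp by simp
  have n': "n = 5 * area K + 4 * m + Suc (length w)" using n len by simp
  have IHE: "?sc K' p \<le> ?sc K' q + ?n w' + 1 - int m'"
    if "walk (snd e) w' (fst e)" "finite_assignment K'" "5 * area K' + 4 * m' + Suc (length w') < n" "c (?P m' @ e # w') K' \<noteq> 0" for m' w' K'
  proof -
    have "excess_claim (5 * area K' + length (?P m' @ e # w'))" using IH that(3) len by simp
    then show ?thesis using nb that lp unfolding excess_claim_def by blast
  qed
  have IHL: "?sc K' p \<le> ?sc K' q + ?n l"
    if "is_loop l" "finite_assignment K'" "5 * area K' + length l < n" "c l K' \<noteq> 0" for l K'
  proof -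
    have "square_count K' p \<le> square_count K' q + undirected_count e l"
      using IH[OF that(3)] nb that unfolding lipschitz_claim_def by blast
    then show ?thesis by linarith
  qed
  have IHP: "c (?P (Suc j)) K' = (if j = 0 \<and> K' = single ?p then 1 else 0)"
    if "finite_assignment K'" "5 * area K' + 4 * Suc j < n" for j K'
    using IH[OF that(2)] nb that unfolding power_claim_def by blast
  obtain W where W: "?P m @ e # w = e # W" by (cases m) auto
  have Wm: "m = 0 \<Longrightarrow> W = w" "\<And>m'. m = Suc m' \<Longrightarrow> W = ?s @ ?P m' @ e # w" using W by auto
  have loopW: "is_loop (e # W)" using loop W by simp
  \<comment> \<open>the common value of the two terms that cancel\<close>
  define X where "X = (if m \<ge> 1 \<and> K ?p \<ge> 1 then c (?P (m - 1) @ e # w) (remove_plaquette K ?p) else 0)"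

  \<comment> \<open>splittings at a copy of $e^{-1}$, which lies in \<open>w\<close>\<close>
  have neg: "convolution (drop (Suc i) W) (take i W) K = 0" if i: "i < length W" "W ! i = inv_edge e" for i
  proof -
    have "?P m @ e # w = (e # take i W) @ inv_edge e # drop (Suc i) W"
      using W id_take_nth_drop[OF i(1)] i(2) by simp
    from power_Cons_split_inv[OF this ne s(4)] obtain a where
      a: "w = a @ inv_edge e # drop (Suc i) W" "e # take i W = ?P m @ e # a" by blast
    let ?b = "drop (Suc i) W"
    have wa: "walk (snd e) a (snd e)" "walk (fst e) ?b (fst e)" using w a(1) by auto
    have cw: "?n w = ?n a + 1 + ?n ?b" using le by (subst a(1)) (simp add: undirected_count_Cons)
    have lw: "length w = length a + Suc (length ?b)" by (subst a(1)) simp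
    show ?thesis
    proof (rule convolution_eq_0[OF fin])
      fix K1 K2
      assume d: "(K1, K2) \<in> decompositions K" and f: "finite_assignment K1" "finite_assignment K2"
        "area K1 \<le> area K" "area K2 \<le> area K" and nz: "c ?b K1 \<noteq> 0" "c (take i W) K2 \<noteq> 0"
      have 1: "?sc K1 p \<le> ?sc K1 q + ?n ?b"
        by (rule IHL) (use f nz wa n' lw in \<open>auto simp: is_loop_iff_walk\<close>)
      have 2: "?sc K2 p \<le> ?sc K2 q + ?n a + 2 - int m"
      proof (cases m)
        case 0
        then have t: "take i W = a" using a(2) by simp
        have "?sc K2 p \<le> ?sc K2 q + ?n a"
          by (rule IHL) (use f nz wa n' lw t in \<open>auto simp: is_loop_iff_walk\<close>)
        then show ?thesis using 0 by simp
      next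
        case (Suc m')
        then have t: "take i W = ?s @ ?P m' @ e # a" using a(2) by simp
        have "c (?s @ (?P m' @ e # a)) K2 = c ((?P m' @ e # a) @ ?s) K2"
          using s(1) wp[of m'] wa le f by (intro c_commute) (auto simp: is_loop_append)
        then have "c (?P m' @ e # (a @ ?s)) K2 \<noteq> 0" using nz t by simp
        then have "?sc K2 p \<le> ?sc K2 q + ?n (a @ ?s) + 1 - int m'"
          by (intro IHE) (use f wa s(1,5) n' lw Suc in auto)
        then show ?thesis using Suc undirected_count_rest(1)[OF pe] by simp
      qed
      show False using 1 2 bad cw decompositionsD(3)[OF d, of p] decompositionsD(3)[OF d, of q] by simp
    qed
  qed

  \<comment> \<open>the second copy of \<open>e\<close>, which ends the first turn, is at position 3 of \<open>W\<close>\<close>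
  have pos: "convolution (e # drop (Suc i) W) (e # take i W) K = (if m \<ge> 1 \<and> i = 3 then X else 0)"
    if i: "i < length W" "W ! i = e" for i
  proof -
    let ?b = "drop (Suc i) W" and ?u = "e # take i W"
    have lu: "length ?u = Suc i" using i(1) by simp
    have eq: "?P m @ e # w = ?u @ e # ?b"
      using W id_take_nth_drop[OF i(1)] i(2) by simp
    from power_Cons_split[OF eq s(3)] consider
        j where "j \<le> m" "?u = ?P j" "e # ?b = ?P (m - j) @ e # w"
      | a where "w = a @ e # ?b" "?u = ?P m @ e # a" by blast
    then show ?thesis
    proof cases
      case (1 j)
      then have ij: "Suc i = 4 * j" using lu len by metis
      then obtain j' where j: "j = Suc j'" by (cases j) auto
      have P: "c ?u K2 = (if j' = 0 \<and> K2 = single ?p then 1 else 0)"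
        if "finite_assignment K2" "area K2 \<le> area K" for K2
        using IHP[OF that(1), of j'] that 1 j n' by simp
      show ?thesis
      proof (cases "j' = 0")
        case True
        have "convolution (e # ?b) ?u K = (if K ?p \<ge> 1 then c (e # ?b) (remove_plaquette K ?p) else 0)"
          by (rule convolution_single[OF fin]) (use P True in auto)
        then show ?thesis using 1 j True ij by (simp add: X_def)
      next
        case False
        have "convolution (e # ?b) ?u K = 0"
          by (rule convolution_eq_0[OF fin]) (use P False in auto)
        then show ?thesis using False ij j by simp
      qed
    next
      case (2 a)
      have wa: "walk (snd e) a (fst e)" "walk (snd e) ?b (fst e)"
        using w 2(1) by (metis walk_append walk.simps(2))+
      have cw: "?n w = ?n a + 1 + ?n ?b" using le by (subst 2(1)) (simp add: undirected_count_Cons)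
      have lw: "length w = length a + Suc (length ?b)" by (subst 2(1)) simp
      have "length ?u = 4 * m + Suc (length a)" using 2(2) len by (metis length_Cons length_append)
      then have i3: "\<not> (m \<ge> 1 \<and> i = 3)" using lu by auto
      have "convolution (e # ?b) ?u K = 0"
      proof (rule convolution_eq_0[OF fin])
        fix K1 K2
        assume d: "(K1, K2) \<in> decompositions K" and f: "finite_assignment K1" "finite_assignment K2"
          "area K1 \<le> area K" "area K2 \<le> area K" and nz: "c (e # ?b) K1 \<noteq> 0" "c ?u K2 \<noteq> 0"
        have 1: "?sc K1 p \<le> ?sc K1 q + ?n ?b + 1 - int 0"
          by (rule IHE) (use f nz wa n' lw in auto)
        have 2: "?sc K2 p \<le> ?sc K2 q + ?n a + 1 - int m"
          by (rule IHE) (use f nz wa n' lw 2(2) in auto)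
        show False using 1 2 bad cw decompositionsD(3)[OF d, of p] decompositionsD(3)[OF d, of q] by simp
      qed
      then show ?thesis using i3 by auto
    qed
  qed
  have pos_sum: "(\<Sum>i | i < length W \<and> W ! i = e. convolution (e # drop (Suc i) W) (e # take i W) K) = X"
  proof -
    have "(\<Sum>i | i < length W \<and> W ! i = e. convolution (e # drop (Suc i) W) (e # take i W) K) =
        (\<Sum>i | i < length W \<and> W ! i = e. if i = 3 then (if m \<ge> 1 then X else 0) else 0)"
      by (rule sum.cong) (auto simp: pos)
    also have "\<dots> = (if 3 < length W \<and> W ! 3 = e then (if m \<ge> 1 then X else 0) else 0)"
      by (subst sum.delta) auto
    also have "\<dots> = X"
    proof (cases m)
      case 0
      then show ?thesis by (simp add: X_def)
    next
      case (Suc m')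
      have "W = ?s @ ?P m' @ e # w" by (rule Wm(2)[OF Suc])
      moreover have "(?P m' @ e # w) ! 0 = e" by (cases m') auto
      ultimately have "3 < length W \<and> W ! 3 = e" using s(5) by (simp add: nth_append)
      then show ?thesis using Suc by simp
    qed
    finally show ?thesis .
  qed

  have rem: "finite_assignment (remove_plaquette K r)" "Suc (area (remove_plaquette K r)) = area K"
    if "K r \<ge> 1" for r
    using that fin by (simp_all add: remove_plaquette_finite area_remove_plaquette)
  have scr: "?sc K x = ?sc (remove_plaquette K r) x + (if x = r \<or> x = plaquette_inv r then 1 else 0)"
    if "K r \<ge> 1" for r x
    using square_count_remove[of K r x, OF that] by simp
  have nW: "length W = 4 * m + length w" using arg_cong[OF W, of length] len by simp
  have wW: "walk (snd e) W (fst e)" using loopW by simp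

  \<comment> \<open>undoing a turn; without turns, the path around \<open>p\<close> replaces \<open>e\<close> and the Lipschitz bound applies\<close>
  have def_p: "c (plaquette_rest (inv_edge e) ?p @ W) (remove_plaquette K ?p) = X" if K: "K ?p \<ge> 1"
  proof (cases m)
    case 0
    have "c (plaquette_rest (inv_edge e) ?p @ w) (remove_plaquette K ?p) = 0"
    proof (rule ccontr)
      assume "\<not> ?thesis"
      then have "?sc (remove_plaquette K ?p) p \<le> ?sc (remove_plaquette K ?p) q + ?n (plaquette_rest (inv_edge e) ?p @ w)"
        by (intro IHL) (use rem[OF K] w plaquette_rest_props(1,5)[OF pe'] n' in \<open>auto simp: is_loop_append\<close>)
      then show False using bad 0 scr[OF K, of p] scr[OF K, of q] pq undirected_count_rest(2)[OF pe'] by (auto split: if_splits)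
    qed
    then show ?thesis using 0 Wm by (simp add: X_def)
  next
    case (Suc m')
    have WW: "W = ?s @ ?P m' @ e # w" by (rule Wm(2)[OF Suc])
    have r: "plaquette_rest (inv_edge e) ?p = rev (map inv_edge ?s)" by (rule s(6))
    have "c (rev (map inv_edge ?s) @ ?s @ ?P m' @ e # w) (remove_plaquette K ?p) = c (?P m' @ e # w) (remove_plaquette K ?p)"
    proof (rule c_cancel_path)
      have "walk (fst e) (rev (map inv_edge ?s)) (snd e)" using s(1) by (simp add: walk_rev)
      then have "walk (fst e) (rev (map inv_edge ?s) @ W) (fst e)" using wW by auto
      then show "is_loop (rev (map inv_edge ?s) @ ?s @ ?P m' @ e # w)" using WW is_loop_iff_walk by metis
    qed (rule rem[OF K])
    then show ?thesis using K Suc WW r by (simp add: X_def)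
  qed

  \<comment> \<open>the plaquette of \<open>q\<close> is lost, which makes the violation worse\<close>
  have def_q: "c (plaquette_rest (inv_edge e) ?q @ W) (remove_plaquette K ?q) = 0" (is "c (?t @ W) ?K = 0")
    if K: "K ?q \<ge> 1"
  proof (rule ccontr)
    assume nz: "\<not> ?thesis"
    note t = plaquette_rest_props[OF qe'] and ct = undirected_count_rest(2)[OF qe']
    have "?sc ?K p \<le> ?sc ?K q + ?n w + 2 - int m"
    proof (cases m)
      case 0
      have "?sc ?K p \<le> ?sc ?K q + ?n (?t @ w)"
        by (rule IHL) (use nz rem[OF K] w t(1,5) n' 0 Wm in \<open>auto simp: is_loop_append\<close>)
      then show ?thesis using ct 0 by simp
    next
      case (Suc m')
      have WW: "W = ?s @ ?P m' @ e # w" by (rule Wm(2)[OF Suc])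
      have "c ((?t @ ?s) @ (?P m' @ e # w)) ?K = c ((?P m' @ e # w) @ (?t @ ?s)) ?K"
        using s(1) t(1) wp[of m'] w le rem[OF K] by (intro c_commute) (auto simp: is_loop_append)
      then have "c (?P m' @ e # (w @ ?t @ ?s)) ?K \<noteq> 0" using nz WW by simp
      then have "?sc ?K p \<le> ?sc ?K q + ?n (w @ ?t @ ?s) + 1 - int m'"
        by (intro IHE) (use rem[OF K] w s(1,5) t(1,5) n' Suc in auto)
      then show ?thesis using Suc ct undirected_count_rest(1)[OF pe] by simp
    qed
    then show False using bad scr[OF K, of p] scr[OF K, of q] pq by auto
  qed

  \<comment> \<open>one turn more lowers the bound by one, as much as the number of copies of \<open>p\<close> drops\<close>
  have ext_p: "c (e # ?s @ e # W) (remove_plaquette K p) = 0" (is "c _ ?K = 0") if K: "K p \<ge> 1"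
  proof (rule ccontr)
    assume nz: "\<not> ?thesis"
    have "e # ?s @ e # W = ?P (Suc m) @ e # w" using W by simp
    then have "?sc ?K p \<le> ?sc ?K q + ?n w + 1 - int (Suc m)"
      using nz rem[OF K] w n' by (intro IHE) auto
    then show False using bad scr[OF K, of p] scr[OF K, of q] pq by auto
  qed

  have ext_q: "c (e # plaquette_rest e q @ e # W) (remove_plaquette K q) = 0" (is "c (e # ?t @ e # W) ?K = 0")
    if K: "K q \<ge> 1"
  proof (rule ccontr)
    assume nz: "\<not> ?thesis"
    note t = plaquette_rest_props[OF qe]
    have "c ((e # ?t) @ (?P m @ e # w)) ?K = c ((?P m @ e # w) @ (e # ?t)) ?K"
      using t(1) wp[of m] w le rem[OF K] by (intro c_commute) (auto simp: is_loop_append)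
    moreover have "e # W @ e # ?t = ?P m @ e # (w @ e # ?t)"
      using arg_cong[OF W, of "\<lambda>l. l @ e # ?t"] by simp
    ultimately have "c (?P m @ e # (w @ e # ?t)) ?K \<noteq> 0" using nz W by (metis append_Cons append_assoc)
    then have "?sc ?K p \<le> ?sc ?K q + ?n (w @ e # ?t) + 1 - int m"
      by (intro IHE) (use rem[OF K] w t(1,5) n' le in auto)
    then show False
      using bad scr[OF K, of p] scr[OF K, of q] pq undirected_count_rest(1)[OF qe] le
      by (auto simp: undirected_count_Cons)
  qed

  have neg_sum: "(\<Sum>i | i < length W \<and> W ! i = inv_edge e. convolution (drop (Suc i) W) (take i W) K) = 0"
    by (rule sum.neutral) (auto simp: neg)
  have "?p \<noteq> ?q" using pq by (simp add: plaquette_inv_eq_iff)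
  then have "c (e # W) K = 0"
    unfolding master[OF loopW fin] neg_sum pos_sum at ati sum_pair[OF pq(1)] sum_pair[OF \<open>?p \<noteq> ?q\<close>]
    using def_p def_q ext_p ext_q by (auto simp: X_def)
  then show False using nz W by simp
qed

text \<open>This is the case \<open>m = 0\<close> of the bound above.\<close>

lemma edge_step:
  assumes E: "excess_claim (5 * area K + length l)" and nb: "neighbours e p q"
    and l: "is_loop l" "finite_assignment K" "c l K \<noteq> 0" and e: "e \<in> set l \<or> inv_edge e \<in> set l"
  shows "square_count K p \<le> square_count K q + undirected_count e l"
proof -
  have *: "square_count K p \<le> square_count K q + undirected_count e l"
    if nb: "neighbours e p q" and e: "e \<in> set l" for e p q
  proof -
    obtain xs ys where xy: "l = xs @ e # ys" using e by (metis split_list)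
    have loop: "is_loop (e # ys @ xs)" using l(1) is_loop_commute[of xs "e # ys"] by (simp add: xy)
    have "c (e # ys @ xs) K = c l K" using c_commute[of xs "e # ys" K] l by (simp add: xy)
    then have "int (square_count K p) \<le> int (square_count K q) + int (undirected_count e (ys @ xs)) + 1 - int 0"
      using E[unfolded excess_claim_def, rule_format, OF nb, of 0 "ys @ xs" K] loop l by (simp add: xy)
    moreover have "undirected_count e l = undirected_count e (ys @ xs) + 1"
      using nb by (simp add: xy undirected_count_Cons neighbours_def)
    ultimately show ?thesis by simp
  qed
  show ?thesis using e
  proof
    assume "inv_edge e \<in> set l"
    from *[OF neighbours_inv[OF nb] this] show ?thesis by simp
  qed (rule *[OF nb])
qed

text \<open>The plaquettes at \<open>f\<close> are neither \<open>p\<close> nor \<open>q\<close> and do not contain \<open>e\<close>. So the deformations at \<open>f\<close> preserve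
  both sides of the inequality, and the splittings distribute them over the two parts.\<close>

lemma far_step:
  assumes L: "\<And>k. k < 5 * area K + length l \<Longrightarrow> lipschitz_claim k" and nb: "neighbours e p q"
    and l: "is_loop l" "finite_assignment K" "c l K \<noteq> 0" and f: "f \<in> set l"
    and far: "\<And>r. r \<in> {p, q, plaquette_inv p, plaquette_inv q} \<Longrightarrow> f \<notin> set (plaquette_loop r)"
  shows "square_count K p \<le> square_count K q + undirected_count e l"
proof (rule ccontr)
  assume "\<not> ?thesis"
  then have bad: "square_count K p > square_count K q + undirected_count e l" by simp
  obtain xs ys where xy: "l = xs @ f # ys" using f by (metis split_list)
  define w where "w = ys @ xs"
  have loop: "is_loop (f # w)" using l(1) is_loop_commute[of xs "f # ys"] by (simp add: xy w_def)
  have cl: "c (f # w) K = c l K" using c_commute[of xs "f # ys" K] l by (simp add: xy w_def)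
  have at: "lattice_edge e" "plaquettes_at e = {p, q}" using nb by (auto simp: neighbours_def)
  then have ati: "plaquettes_at (inv_edge e) = {plaquette_inv p, plaquette_inv q}" by (simp add: plaquettes_at_inv)
  have "f \<noteq> e" "f \<noteq> inv_edge e" using at ati far unfolding plaquettes_at_def by blast+
  note fe = this
  have cw: "undirected_count e l = undirected_count e w"
    using fe at by (simp add: xy w_def undirected_count_Cons)
  have lw: "length l = Suc (length w)" by (simp add: xy w_def)
  have lf: "lattice_edge f" and ww: "walk (snd f) w (fst f)" using loop by simp_all
  have IH: "square_count K' p \<le> square_count K' q + undirected_count e l'"
    if "is_loop l'" "finite_assignment K'" "5 * area K' + length l' < 5 * area K + length l" "c l' K' \<noteq> 0" for l' K'
    using L[OF that(3)] nb that unfolding lipschitz_claim_def by blast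
  have split: "convolution a b K = 0"
    if "is_loop a" "is_loop b" "length a < length l" "length b < length l"
      "undirected_count e a + undirected_count e b \<le> undirected_count e w" for a b
  proof (rule convolution_eq_0[OF l(2)])
    fix K1 K2
    assume d: "(K1, K2) \<in> decompositions K" and g: "finite_assignment K1" "finite_assignment K2"
      "area K1 \<le> area K" "area K2 \<le> area K" "c a K1 \<noteq> 0" "c b K2 \<noteq> 0"
    have "square_count K1 p \<le> square_count K1 q + undirected_count e a"
      "square_count K2 p \<le> square_count K2 q + undirected_count e b"
      using g that by (auto intro!: IH)
    then show False using bad cw that(5) decompositionsD(3)[OF d, of p] decompositionsD(3)[OF d, of q] by simp
  qed
  have cut: "undirected_count e (take i w) + undirected_count e (drop (Suc i) w) \<le> undirected_count e w"
    if "i < length w" for i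
    using arg_cong[OF id_take_nth_drop[OF that], of "undirected_count e"] at(1)
    by (simp add: undirected_count_Cons)
  have neg: "convolution (drop (Suc i) w) (take i w) K = 0" if "i < length w" "w ! i = inv_edge f" for i
    using walk_split[OF ww that] that cut[of i] lw by (intro split) (auto simp: is_loop_iff_walk)
  have pos: "convolution (f # drop (Suc i) w) (f # take i w) K = 0" if "i < length w" "w ! i = f" for i
    using walk_split[OF ww that] that cut[of i] lw lf fe at(1) by (intro split) (auto simp: undirected_count_Cons)
  have deform: "c l' (remove_plaquette K r) = 0"
    if r: "r \<in> plaquettes_at f \<or> r \<in> plaquettes_at (inv_edge f)" "K r \<ge> 1" and l': "is_loop l'"
      "undirected_count e l' \<le> undirected_count e w" "length l' \<le> length l + 4" for r l'
  proof (rule ccontr)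
    assume nz: "\<not> ?thesis"
    have K': "finite_assignment (remove_plaquette K r)" "Suc (area (remove_plaquette K r)) = area K"
      using r(2) l(2) by (simp_all add: remove_plaquette_finite area_remove_plaquette)
    have "square_count (remove_plaquette K r) p \<le> square_count (remove_plaquette K r) q + undirected_count e l'"
      using nz K' l' by (intro IH) auto
    moreover have "r \<notin> {p, q, plaquette_inv p, plaquette_inv q}"
    proof
      assume r': "r \<in> {p, q, plaquette_inv p, plaquette_inv q}"
      then have "plaquette_inv r \<in> {p, q, plaquette_inv p, plaquette_inv q}" by auto
      moreover have "f \<in> set (plaquette_loop r) \<or> f \<in> set (plaquette_loop (plaquette_inv r))"
        using r(1) inv_edge_in_plaquette_loop[of f "plaquette_inv r"] by (auto simp: plaquettes_at_def)
      ultimately show False using r' far by blast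
    qed
    then have "square_count (remove_plaquette K r) p = square_count K p"
      "square_count (remove_plaquette K r) q = square_count K q"
      using square_count_remove[of K r p, OF r(2)] square_count_remove[of K r q, OF r(2)] by auto
    ultimately show False using bad cw l'(2) by simp
  qed
  have rest0: "undirected_count e (plaquette_rest g r) = 0"
    if g: "g = f \<or> g = inv_edge f" "r \<in> plaquettes_at g" for g r
  proof -
    have "r \<notin> {p, q, plaquette_inv p, plaquette_inv q}"
    proof
      assume r': "r \<in> {p, q, plaquette_inv p, plaquette_inv q}"
      then have "plaquette_inv r \<in> {p, q, plaquette_inv p, plaquette_inv q}" by auto
      moreover have "f \<in> set (plaquette_loop r) \<or> f \<in> set (plaquette_loop (plaquette_inv r))"
        using g inv_edge_in_plaquette_loop[of f "plaquette_inv r"] by (auto simp: plaquettes_at_def)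
      ultimately show False using r' far by blast
    qed
    then have "r \<notin> plaquettes_at e" "r \<notin> plaquettes_at (inv_edge e)" using at ati by auto
    then have "e \<notin> set (plaquette_loop r)" "inv_edge e \<notin> set (plaquette_loop r)"
      by (auto simp: plaquettes_at_def)
    then show ?thesis using plaquette_rest_props(2)[OF g(2)] by (auto simp: undirected_count_eq_0)
  qed
  have dn: "c (plaquette_rest (inv_edge f) r @ w) (remove_plaquette K r) = 0"
    if r: "r \<in> plaquettes_at (inv_edge f)" "K r \<ge> 1" for r
  proof (rule deform)
    show "is_loop (plaquette_rest (inv_edge f) r @ w)"
      using plaquette_rest_props(1)[OF r(1)] ww by (auto simp: is_loop_append)
  qed (use r rest0[of "inv_edge f" r] plaquette_rest_props(5)[OF r(1)] lw in auto)
  have dp: "c (f # plaquette_rest f r @ f # w) (remove_plaquette K r) = 0"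
    if r: "r \<in> plaquettes_at f" "K r \<ge> 1" for r
  proof (rule deform)
    show "is_loop (f # plaquette_rest f r @ f # w)"
      using plaquette_rest_props(1)[OF r(1)] ww lf by auto
  qed (use r rest0[of f r] plaquette_rest_props(5)[OF r(1)] lw fe at(1) in \<open>auto simp: undirected_count_Cons\<close>)
  have "c (f # w) K = 0"
    unfolding master[OF loop l(2)] by (simp add: neg pos dn dp)
  then show False using cl l(3) by simp
qed

text \<open>The loop winds around the rim of two squares. The hypotheses \<open>edge\<close> and \<open>far\<close> are what the previous two lemmas
  provide at the current stage of the induction. By \<open>far\<close>, applied along a ray, there are no
  plaquettes to the left and to the right of the domino; by \<open>edge\<close>, each square has at most as many
  plaquettes as the loop has copies of its outer vertical edge. Balance there shows that each square carries
  plaquettes of one orientation only, and balance at the common edge that their numbers agree.\<close>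

lemma domino_horizontal:
  assumes loop: "is_loop l" "\<not> has_backtrack l" "l \<noteq> []" and fin: "finite_assignment K" and nz: "c l K \<noteq> 0"
    and edge: "\<And>e p q. neighbours e p q \<Longrightarrow> e \<in> set l \<or> inv_edge e \<in> set l \<Longrightarrow> square_count K p \<le> square_count K q + undirected_count e l"
    and far: "\<And>e p q f. neighbours e p q \<Longrightarrow> f \<in> set l \<Longrightarrow>
      (\<And>r. r \<in> {p, q, plaquette_inv p, plaquette_inv q} \<Longrightarrow> f \<notin> set (plaquette_loop r)) \<Longrightarrow> square_count K p \<le> square_count K q + undirected_count e l"
    and sub: "\<And>f. f \<in> set l \<Longrightarrow> \<exists>s. f \<in> set (plaquette_loop (Plaquette (x, y) s)) \<or> f \<in> set (plaquette_loop (Plaquette (x + 1, y) s))"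
    and e: "((x + 1, y), (x + 1, y + 1)) \<notin> set l" "((x + 1, y + 1), (x + 1, y)) \<notin> set l"
  shows "square_count K (square_at x y) = square_count K (square_at (x + 1) y)"
proof -
  let ?vs = "[(x, y), (x, y + 1), (x + 1, y + 1), (x + 2, y + 1), (x + 2, y), (x + 1, y)]"
  have bal: "balanced l K" using balanced_if_nonzero loop fin nz by blast
  have hex: "f \<in> set (zip ?vs (rotate1 ?vs)) \<or> inv_edge f \<in> set (zip ?vs (rotate1 ?vs))" if f: "f \<in> set l" for f
  proof -
    obtain s where s: "f \<in> set (plaquette_loop (Plaquette (x, y) s)) \<or> f \<in> set (plaquette_loop (Plaquette (x + 1, y) s))"
      using sub[OF f] by blast
    have s': "f \<in> set (plaquette_loop (Plaquette (x, y) True) @ plaquette_loop (Plaquette (x, y) False) @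
        plaquette_loop (Plaquette (x + 1, y) True) @ plaquette_loop (Plaquette (x + 1, y) False))"
      using s by (cases s) (simp_all, blast+)
    have "f \<noteq> ((x + 1, y), (x + 1, y + 1))" "f \<noteq> ((x + 1, y + 1), (x + 1, y))" using e f by auto
    then have "f = ((x, y), (x, y + 1)) \<or>
      f = ((x, y + 1), (x + 1, y + 1)) \<or>
      f = ((x + 1, y + 1), (x + 2, y + 1)) \<or>
      f = ((x + 2, y + 1), (x + 2, y)) \<or>
      f = ((x + 2, y), (x + 1, y)) \<or>
      f = ((x + 1, y), (x, y)) \<or>
      f = ((x, y + 1), (x, y)) \<or>
      f = ((x + 1, y + 1), (x, y + 1)) \<or>
      f = ((x + 2, y + 1), (x + 1, y + 1)) \<or>
      f = ((x + 2, y), (x + 2, y + 1)) \<or>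
      f = ((x + 1, y), (x + 2, y)) \<or>
      f = ((x, y), (x + 1, y))"
      using s' unfolding plaquette_loop_pos plaquette_loop_neg append.simps list.set insert_iff empty_iff add.assoc one_add_one
      by (elim disjE; simp)
    then show ?thesis by (elim disjE) simp_all
  qed
  have one: "f \<in> set l \<longleftrightarrow> inv_edge f \<notin> set l" if "f \<in> set (zip ?vs (rotate1 ?vs))" for f
    by (rule reduced_loop_in_cycle[OF _ _ loop hex that]) auto
  let ?f = "((x, y), (x, y + 1))" and ?g = "((x + 2, y), (x + 2, y + 1))"
  have f: "?f \<in> set l \<longleftrightarrow> inv_edge ?f \<notin> set l" by (rule one) simp
  have g: "?g \<in> set l \<longleftrightarrow> inv_edge ?g \<notin> set l" using one[of "inv_edge ?g"] by auto
  have out: "((a, b), (a, b + 1)) \<notin> set l" "((a, b + 1), (a, b)) \<notin> set l"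
    if "a < x \<or> a > x + 2" for a b
    using that sub[of "((a, b), (a, b + 1))"] sub[of "((a, b + 1), (a, b))"]
    by (auto simp: edge_of_square_iff split: if_splits)
  have nf: "neighbours ?f (square_at x y) (Plaquette (x - 1, y) False)" by (rule neighbours_simps)
  have ng: "neighbours ?g (square_at (x + 2) y) (Plaquette (x + 1, y) False)"
    using neighbours_simps(1)[of "x + 2" y] by (simp add: add.commute)
  \<comment> \<open>the far right edge of the loop is off all squares of the ray to the left\<close>
  have "square_count K (square_at (x - 1) y) = 0"
  proof (rule escape_zero_left[OF fin])
    fix i :: nat
    let ?a = "x - 1 - int i"
    obtain g where g: "g \<in> set l" "g = ?g \<or> g = inv_edge ?g" using g by blast
    have "square_count K (square_at ?a y) \<le> square_count K (Plaquette (?a - 1, y) False) + undirected_count ((?a, y), (?a, y + 1)) l"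
      using g(2) by (intro far[OF neighbours_simps(1) g(1)]) (auto simp: edge_of_square_iff)
    moreover have "undirected_count ((?a, y), (?a, y + 1)) l = 0"
      using out[of ?a y] by (simp add: undirected_count_eq_0)
    ultimately show "square_count K (square_at ?a y) \<le> square_count K (square_at (?a - 1) y)"
      by (simp add: square_count_False)
  qed
  then have "K (square_at x y) = 0 \<or> K (plaquette_inv (square_at x y)) = 0"
    using f by (intro outer_one_sided[OF bal nf _ f] edge[OF nf]) (auto simp: square_count_False)
  moreover have "square_count K (square_at (x + 2) y) = 0"
  proof (rule escape_zero_right[OF fin])
    fix i :: nat
    let ?a = "x + 2 + int i"
    obtain f where f: "f \<in> set l" "f = ?f \<or> f = inv_edge ?f" using f by blast
    have nb: "neighbours ((?a + 1, y), (?a + 1, y + 1)) (Plaquette (?a, y) False) (square_at (?a + 1) y)"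
      by (rule neighbours_shifted)
    have "square_count K (Plaquette (?a, y) False) \<le> square_count K (square_at (?a + 1) y) + undirected_count ((?a + 1, y), (?a + 1, y + 1)) l"
      using f(2) by (intro far[OF nb f(1)]) (auto simp: edge_of_square_iff)
    moreover have "undirected_count ((?a + 1, y), (?a + 1, y + 1)) l = 0"
      using out[of "?a + 1" y] by (simp add: undirected_count_eq_0)
    ultimately show "square_count K (square_at ?a y) \<le> square_count K (square_at (?a + 1) y)"
      by (simp add: square_count_False)
  qed
  then have "K (Plaquette (x + 1, y) False) = 0 \<or> K (plaquette_inv (Plaquette (x + 1, y) False)) = 0"
    using g by (intro outer_one_sided[OF bal neighbours_commute[OF ng] _ g] edge[OF neighbours_commute[OF ng]]) auto
  moreover have "neighbours ((x + 1, y), (x + 1, y + 1)) (square_at (x + 1) y) (Plaquette (x, y) False)"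
    using neighbours_simps(1)[of "x + 1" y] by simp
  ultimately have "square_count K (square_at (x + 1) y) = square_count K (Plaquette (x, y) False)"
    by (intro one_sided_balance[OF bal]) (use e in auto)
  then show ?thesis by (simp add: square_count_False)
qed

text \<open>The same argument with the rays downwards and upwards and with the outer horizontal edges.\<close>

lemma domino_vertical:
  assumes loop: "is_loop l" "\<not> has_backtrack l" "l \<noteq> []" and fin: "finite_assignment K" and nz: "c l K \<noteq> 0"
    and edge: "\<And>e p q. neighbours e p q \<Longrightarrow> e \<in> set l \<or> inv_edge e \<in> set l \<Longrightarrow> square_count K p \<le> square_count K q + undirected_count e l"
    and far: "\<And>e p q f. neighbours e p q \<Longrightarrow> f \<in> set l \<Longrightarrow>
      (\<And>r. r \<in> {p, q, plaquette_inv p, plaquette_inv q} \<Longrightarrow> f \<notin> set (plaquette_loop r)) \<Longrightarrow> square_count K p \<le> square_count K q + undirected_count e l"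
    and sub: "\<And>f. f \<in> set l \<Longrightarrow> \<exists>s. f \<in> set (plaquette_loop (Plaquette (x, y) s)) \<or> f \<in> set (plaquette_loop (Plaquette (x, y + 1) s))"
    and e: "((x, y + 1), (x + 1, y + 1)) \<notin> set l" "((x + 1, y + 1), (x, y + 1)) \<notin> set l"
  shows "square_count K (square_at x y) = square_count K (square_at x (y + 1))"
proof -
  let ?vs = "[(x, y), (x, y + 1), (x, y + 2), (x + 1, y + 2), (x + 1, y + 1), (x + 1, y)]"
  have bal: "balanced l K" using balanced_if_nonzero loop fin nz by blast
  have hex: "f \<in> set (zip ?vs (rotate1 ?vs)) \<or> inv_edge f \<in> set (zip ?vs (rotate1 ?vs))" if f: "f \<in> set l" for f
  proof -
    obtain s where s: "f \<in> set (plaquette_loop (Plaquette (x, y) s)) \<or> f \<in> set (plaquette_loop (Plaquette (x, y + 1) s))"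
      using sub[OF f] by blast
    have s': "f \<in> set (plaquette_loop (Plaquette (x, y) True) @ plaquette_loop (Plaquette (x, y) False) @
        plaquette_loop (Plaquette (x, y + 1) True) @ plaquette_loop (Plaquette (x, y + 1) False))"
      using s by (cases s) (simp_all, blast+)
    have "f \<noteq> ((x, y + 1), (x + 1, y + 1))" "f \<noteq> ((x + 1, y + 1), (x, y + 1))" using e f by auto
    then have "f = ((x, y), (x, y + 1)) \<or>
      f = ((x, y + 1), (x, y + 2)) \<or>
      f = ((x, y + 2), (x + 1, y + 2)) \<or>
      f = ((x + 1, y + 2), (x + 1, y + 1)) \<or>
      f = ((x + 1, y + 1), (x + 1, y)) \<or>
      f = ((x + 1, y), (x, y)) \<or>
      f = ((x, y + 1), (x, y)) \<or>
      f = ((x, y + 2), (x, y + 1)) \<or>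
      f = ((x + 1, y + 2), (x, y + 2)) \<or>
      f = ((x + 1, y + 1), (x + 1, y + 2)) \<or>
      f = ((x + 1, y), (x + 1, y + 1)) \<or>
      f = ((x, y), (x + 1, y))"
      using s' unfolding plaquette_loop_pos plaquette_loop_neg append.simps list.set insert_iff empty_iff add.assoc one_add_one
      by (elim disjE; simp)
    then show ?thesis by (elim disjE) simp_all
  qed
  have one: "f \<in> set l \<longleftrightarrow> inv_edge f \<notin> set l" if "f \<in> set (zip ?vs (rotate1 ?vs))" for f
    by (rule reduced_loop_in_cycle[OF _ _ loop hex that]) auto
  let ?f = "((x, y), (x + 1, y))" and ?g = "((x, y + 2), (x + 1, y + 2))"
  have f: "?f \<in> set l \<longleftrightarrow> inv_edge ?f \<notin> set l" using one[of "inv_edge ?f"] by auto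
  have g: "?g \<in> set l \<longleftrightarrow> inv_edge ?g \<notin> set l" by (rule one) simp
  have out: "((a, b), (a + 1, b)) \<notin> set l" "((a + 1, b), (a, b)) \<notin> set l"
    if "b < y \<or> b > y + 2" for a b
    using that sub[of "((a, b), (a + 1, b))"] sub[of "((a + 1, b), (a, b))"]
    by (auto simp: edge_of_square_iff split: if_splits)
  have nf: "neighbours ?f (Plaquette (x, y) False) (square_at x (y - 1))"
    by (rule neighbours_commute[OF neighbours_simps(2)])
  have ng: "neighbours ?g (square_at x (y + 1)) (Plaquette (x, y + 2) False)"
    using neighbours_simps(2)[of x "y + 2"] by (simp add: add.commute)
  \<comment> \<open>the top edge of the loop is off all squares of the ray downwards\<close>
  have "square_count K (square_at x (y - 1)) = 0"
  proof (rule escape_zero_down[OF fin])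
    fix i :: nat
    let ?a = "y - 1 - int i"
    obtain g where g: "g \<in> set l" "g = ?g \<or> g = inv_edge ?g" using g by blast
    have "square_count K (Plaquette (x, ?a) False) \<le> square_count K (square_at x (?a - 1)) + undirected_count ((x, ?a), (x + 1, ?a)) l"
      using g(2) by (intro far[OF neighbours_commute[OF neighbours_simps(2)] g(1)]) (auto simp: edge_of_square_iff)
    moreover have "undirected_count ((x, ?a), (x + 1, ?a)) l = 0"
      using out[of ?a x] by (simp add: undirected_count_eq_0)
    ultimately show "square_count K (square_at x ?a) \<le> square_count K (square_at x (?a - 1))"
      by (simp add: square_count_False)
  qed
  then have "K (Plaquette (x, y) False) = 0 \<or> K (plaquette_inv (Plaquette (x, y) False)) = 0"
    using f by (intro outer_one_sided[OF bal nf _ f] edge[OF nf]) auto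
  moreover have "square_count K (square_at x (y + 2)) = 0"
  proof (rule escape_zero_up[OF fin])
    fix i :: nat
    let ?a = "y + 2 + int i"
    obtain f where f: "f \<in> set l" "f = ?f \<or> f = inv_edge ?f" using f by blast
    have nb: "neighbours ((x, ?a + 1), (x + 1, ?a + 1)) (square_at x ?a) (Plaquette (x, ?a + 1) False)"
      by (rule neighbours_shifted)
    have "square_count K (square_at x ?a) \<le> square_count K (Plaquette (x, ?a + 1) False) + undirected_count ((x, ?a + 1), (x + 1, ?a + 1)) l"
      using f(2) by (intro far[OF nb f(1)]) (auto simp: edge_of_square_iff)
    moreover have "undirected_count ((x, ?a + 1), (x + 1, ?a + 1)) l = 0"
      using out[of "?a + 1" x] by (simp add: undirected_count_eq_0)
    ultimately show "square_count K (square_at x ?a) \<le> square_count K (square_at x (?a + 1))"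
      by (simp add: square_count_False)
  qed
  then have "K (square_at x (y + 1)) = 0 \<or> K (plaquette_inv (square_at x (y + 1))) = 0"
    using g by (intro outer_one_sided[OF bal ng _ g] edge[OF ng]) (auto simp: square_count_False)
  moreover have "neighbours ((x, y + 1), (x + 1, y + 1)) (square_at x y) (Plaquette (x, y + 1) False)"
    using neighbours_simps(2)[of x "y + 1"] by simp
  ultimately have "square_count K (square_at x y) = square_count K (Plaquette (x, y + 1) False)"
    by (intro one_sided_balance[OF bal]) (use e in auto)
  then show ?thesis by (simp add: square_count_False)
qed

text \<open>A backtrack is removed by induction. A reduced loop contains \<open>e\<close>, or has an edge off both squares, or
  winds around the domino.\<close>

lemma lipschitz_step:
  assumes IH: "\<And>k. k < n \<Longrightarrow> lipschitz_claim k" and E: "excess_claim n"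
  shows "lipschitz_claim n"
  unfolding lipschitz_claim_def
proof (intro allI impI)
  fix e p q l K
  assume nb: "neighbours e p q" and loop: "is_loop l" and fin: "finite_assignment K"
    and n: "5 * area K + length l = n" and nz: "c l K \<noteq> 0"
  note le = nb[unfolded neighbours_def, THEN conjunct1]
  have edge: "square_count K p \<le> square_count K q + undirected_count e l"
    if "neighbours e p q" "e \<in> set l \<or> inv_edge e \<in> set l" for e p q
    using edge_step[OF _ that(1) loop fin nz that(2)] E n by simp
  have far: "square_count K p \<le> square_count K q + undirected_count e l"
    if "neighbours e p q" "f \<in> set l"
      "\<And>r. r \<in> {p, q, plaquette_inv p, plaquette_inv q} \<Longrightarrow> f \<notin> set (plaquette_loop r)" for e p q f
    using far_step[OF _ that(1) loop fin nz that(2,3)] IH n by simp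
  show "square_count K p \<le> square_count K q + undirected_count e l"
  proof (cases "has_backtrack l")
    case True
    then obtain l' where l': "removes_backtrack l l'" unfolding has_backtrack_def by blast
    note r = c_removes_backtrack[OF loop fin l']
    have "lipschitz_claim (5 * area K + length l')" using IH n r(3) by simp
    then have "square_count K p \<le> square_count K q + undirected_count e l'"
      using nb r(1) fin nz[unfolded r(2)] unfolding lipschitz_claim_def by blast
    then show ?thesis using r(4)[of e] by simp
  next
    case red: False
    show ?thesis
    proof (cases "l = [] \<or> e \<in> set l \<or> inv_edge e \<in> set l \<or>
        (\<exists>f\<in>set l. \<forall>r\<in>{p, q, plaquette_inv p, plaquette_inv q}. f \<notin> set (plaquette_loop r))")
      case True
      then show ?thesis
      proof (elim disjE)
        assume "l = []"
        then have "K = (\<lambda>_. 0)" using nz c_Nil[OF fin] by (auto split: if_splits)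
        then show ?thesis by (simp add: square_count_def)
      qed (use edge[OF nb] far[OF nb] in blast)+
    next
      case False
      then have ne: "l \<noteq> []" "e \<notin> set l" "inv_edge e \<notin> set l"
        and sub: "\<And>f. f \<in> set l \<Longrightarrow> \<exists>r\<in>{p, q, plaquette_inv p, plaquette_inv q}. f \<in> set (plaquette_loop r)"
        by blast+
      have pq: "{p, q} = plaquettes_at e" using nb by (simp add: neighbours_def)
      \<comment> \<open>a vertical \<open>e\<close> separates the squares of a horizontal domino\<close>
      have hor: ?thesis if pq: "{p, q} = {Plaquette (x + 1, y) s, Plaquette (x, y) (\<not> s)}"
        and e: "{e, inv_edge e} = {((x + 1, y), (x + 1, y + 1)), ((x + 1, y + 1), (x + 1, y))}" for x y s
      proof -
        have "square_count K (square_at x y) = square_count K (square_at (x + 1) y)"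
        proof (rule domino_horizontal[OF loop red ne(1) fin nz edge far])
          show "\<exists>s. f \<in> set (plaquette_loop (Plaquette (x, y) s)) \<or> f \<in> set (plaquette_loop (Plaquette (x + 1, y) s))"
            if fl: "f \<in> set l" for f
          proof -
            obtain r where "r \<in> {p, q, plaquette_inv p, plaquette_inv q}" and f: "f \<in> set (plaquette_loop r)"
              using sub[OF fl] by blast
            then have "r \<in> {p, q} \<union> plaquette_inv ` {p, q}" by auto
            then have "r \<in> {Plaquette (x + 1, y) s, Plaquette (x, y) (\<not> s), Plaquette (x + 1, y) (\<not> s), Plaquette (x, y) s}"
              unfolding pq by auto
            then show ?thesis using f by auto
          qed
        qed (use e ne in \<open>auto simp: doubleton_eq_iff\<close>)
        then show ?thesis using pq by (cases s) (auto simp: doubleton_eq_iff square_count_False)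
      qed
      have ver: ?thesis if pq: "{p, q} = {Plaquette (x, y) s, Plaquette (x, y + 1) (\<not> s)}"
        and e: "{e, inv_edge e} = {((x, y + 1), (x + 1, y + 1)), ((x + 1, y + 1), (x, y + 1))}" for x y s
      proof -
        have "square_count K (square_at x y) = square_count K (square_at x (y + 1))"
        proof (rule domino_vertical[OF loop red ne(1) fin nz edge far])
          show "\<exists>s. f \<in> set (plaquette_loop (Plaquette (x, y) s)) \<or> f \<in> set (plaquette_loop (Plaquette (x, y + 1) s))"
            if fl: "f \<in> set l" for f
          proof -
            obtain r where "r \<in> {p, q, plaquette_inv p, plaquette_inv q}" and f: "f \<in> set (plaquette_loop r)"
              using sub[OF fl] by blast
            then have "r \<in> {p, q} \<union> plaquette_inv ` {p, q}" by auto
            then have "r \<in> {Plaquette (x, y) s, Plaquette (x, y + 1) (\<not> s), Plaquette (x, y) (\<not> s), Plaquette (x, y + 1) s}"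
              unfolding pq by auto
            then show ?thesis using f by auto
          qed
        qed (use e ne in \<open>auto simp: doubleton_eq_iff\<close>)
        then show ?thesis using pq by (cases s) (auto simp: doubleton_eq_iff square_count_False)
      qed
      show ?thesis using le
      proof (cases e rule: lattice_edge_cases)
        case (up x y)
        then show ?thesis using pq by (intro hor[of "x - 1" y True]) (simp_all add: plaquettes_at_simps)
      next
        case (down x y)
        then show ?thesis using pq by (intro hor[of "x - 1" y False]) (simp_all add: plaquettes_at_simps insert_commute)
      next
        case (right x y)
        then show ?thesis using pq by (intro ver[of x "y - 1" True]) (simp_all add: plaquettes_at_simps)
      next
        case (left x y)
        then show ?thesis using pq by (intro ver[of x "y - 1" False]) (simp_all add: plaquettes_at_simps insert_commute)
      qed
    qed
  qed
qed

text \<open>If \<open>K\<close> charges the square on the other side of \<open>e\<close>, the Lipschitz bound gives zero. Otherwise the expansion at \<open>e\<close>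
  only involves powers of the plaquette. For at least two turns, splitting off one turn cancels with the
  negative deformation, as in the bound above; for one turn only the negative deformation is left, and it
  leads to the null-loop.\<close>

lemma power_step:
  assumes IH: "\<And>k. k < n \<Longrightarrow> power_claim k" and L: "lipschitz_claim n"
  shows "power_claim n"
  unfolding power_claim_def
proof (intro allI impI)
  fix e p q j K
  let ?P = "plaquette_power e p" and ?s = "plaquette_rest e p" and ?p = "plaquette_inv p" and ?q = "plaquette_inv q"
  assume nb: "neighbours e p q" and fin: "finite_assignment K" and n: "5 * area K + 4 * Suc j = n"
  have le: "lattice_edge e" and at: "plaquettes_at e = {p, q}" and pq: "p \<noteq> q" "p \<noteq> ?q" "q \<noteq> ?p"
    using nb neighbours_commute[OF nb] by (auto simp: neighbours_def)
  have pe: "p \<in> plaquettes_at e" using at by auto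
  have ati: "plaquettes_at (inv_edge e) = {?p, ?q}" by (simp add: plaquettes_at_inv at)
  note s = plaquette_rest_props[OF pe]
  note len = length_plaquette_power[OF pe]
  note wp = walk_plaquette_power[OF pe le]
  have loop: "is_loop (?P m)" for m using wp is_loop_iff_walk by blast
  have setP: "set (?P m) \<subseteq> set (plaquette_loop p)" for m
    using s(2) by (induction m) auto
  show "c (?P (Suc j)) K = (if j = 0 \<and> K = single ?p then 1 else 0)"
  proof (cases "K q = 0 \<and> K ?q = 0")
    case False
    have "corner q \<noteq> corner p"
      using pq by (cases p; cases q) (auto simp: plaquette_inv_def)
    have "c (?P (Suc j)) K = 0"
    proof (rule ccontr)
      assume "c (?P (Suc j)) K \<noteq> 0"
      then have "square_count K r \<le> square_count K r' + undirected_count f (?P (Suc j))" if "neighbours f r r'" for f r r'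
        using L that loop fin n len unfolding lipschitz_claim_def by metis
      then have "square_count K q = 0"
        by (rule support_of_plaquette_loop[OF _ fin setP \<open>corner q \<noteq> corner p\<close>])
      then show False using False by (simp add: square_count_def)
    qed
    moreover have "K \<noteq> single ?p" using False pq by (auto simp: single_def plaquette_inv_eq_iff)
    ultimately show ?thesis by simp
  next
    case True
    have IHP: "c (?P (Suc j)) K' = (if j = 0 \<and> K' = single ?p then 1 else 0)"
      if "finite_assignment K'" "5 * area K' + 4 * Suc j < n" for j K'
      using IH[OF that(2)] nb that unfolding power_claim_def by blast
    let ?W = "?s @ ?P j"
    have loopW: "is_loop (e # ?W)" using loop[of "Suc j"] by simp
    have notin: "e \<notin> set (?P j @ ?s) \<or> j \<ge> 1" "inv_edge e \<notin> set ?W"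
      using s(3) plaquette_loop_props(4)[of "e" p] s(2) setP[of j] by (cases j; auto)+
    define X where "X = (if j \<ge> 1 \<and> K ?p \<ge> 1 then c (?P j) (remove_plaquette K ?p) else 0)"
    have neg: "(\<Sum>i | i < length ?W \<and> ?W ! i = inv_edge e. convolution (drop (Suc i) ?W) (take i ?W) K) = 0"
      using notin(2) by (intro sum.neutral) (metis (mono_tags, lifting) mem_Collect_eq nth_mem)
    \<comment> \<open>only the splitting at position 3, which cuts off one turn, can be nonzero\<close>
    have pos: "convolution (e # drop (Suc i) ?W) (e # take i ?W) K = (if j \<ge> 1 \<and> i = 3 then X else 0)"
      if i: "i < length ?W" "?W ! i = e" for i
    proof -
      let ?b = "drop (Suc i) ?W" and ?u = "e # take i ?W"
      have lu: "length ?u = Suc i" using i(1) by simp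
      have "?W = take i ?W @ e # ?b" using id_take_nth_drop[OF i(1)] i(2) by metis
      then have eq: "?P j @ e # ?s = ?u @ e # ?b"
        by (metis append_Cons plaquette_power_Suc' plaquette_power_simps(2))
      obtain k where k: "k \<le> j" "?u = ?P k" "e # ?b = ?P (j - k) @ e # ?s"
        using power_Cons_split[OF eq s(3)] s(3) by (metis in_set_conv_decomp)
      then have ik: "Suc i = 4 * k" using lu len by metis
      then obtain k' where k': "k = Suc k'" by (cases k) auto
      have eb: "e # ?b = ?P (Suc (j - k))" using k(3) plaquette_power_Suc' by metis
      have lt: "4 * Suc k' < 4 * Suc j" using k' k(1) by simp
      have P: "c ?u K2 = (if k' = 0 \<and> K2 = single ?p then 1 else 0)"
        if "finite_assignment K2" "area K2 \<le> area K" for K2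
        using IHP[OF that(1), of k'] that k(1,2) k' n by simp
      show ?thesis
      proof (cases "k' = 0")
        case True
        have "convolution (e # ?b) ?u K = (if K ?p \<ge> 1 then c (e # ?b) (remove_plaquette K ?p) else 0)"
          by (rule convolution_single[OF fin]) (use P True in auto)
        moreover have "Suc (j - k) = j" using True k' k(1) by simp
        ultimately show ?thesis using eb True ik k(1) k' by (simp add: X_def)
      next
        case False
        have "convolution (e # ?b) ?u K = 0"
          by (rule convolution_eq_0[OF fin]) (use P False in auto)
        then show ?thesis using False ik k' by simp
      qed
    qed
    have pos_sum: "(\<Sum>i | i < length ?W \<and> ?W ! i = e. convolution (e # drop (Suc i) ?W) (e # take i ?W) K) = X"
    proof -
      have "(\<Sum>i | i < length ?W \<and> ?W ! i = e. convolution (e # drop (Suc i) ?W) (e # take i ?W) K) =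
          (\<Sum>i | i < length ?W \<and> ?W ! i = e. if i = 3 then (if j \<ge> 1 then X else 0) else 0)"
      proof (rule sum.cong[OF refl])
        fix i assume "i \<in> {i. i < length ?W \<and> ?W ! i = e}"
        then have i: "i < length ?W" "?W ! i = e" by blast+
        show "convolution (e # drop (Suc i) ?W) (e # take i ?W) K = (if i = 3 then (if j \<ge> 1 then X else 0) else 0)"
          unfolding pos[OF i] by auto
      qed
      also have "\<dots> = (if 3 < length ?W \<and> ?W ! 3 = e then (if j \<ge> 1 then X else 0) else 0)"
        by (subst sum.delta) auto
      also have "\<dots> = X"
        using s(5) by (cases j) (simp_all add: X_def nth_append)
      finally show ?thesis .
    qed
    have rem: "finite_assignment (remove_plaquette K r)" "Suc (area (remove_plaquette K r)) = area K"
      if "K r \<ge> 1" for r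
      using that fin by (simp_all add: remove_plaquette_finite area_remove_plaquette)
    have def_p: "c (plaquette_rest (inv_edge e) ?p @ ?W) (remove_plaquette K ?p) = c (?P j) (remove_plaquette K ?p)"
      if K: "K ?p \<ge> 1"
      unfolding s(6)
    proof (rule c_cancel_path[OF _ rem(1)[OF K]])
      have "walk (fst e) (rev (map inv_edge ?s)) (snd e)" using s(1) by (simp add: walk_rev)
      then have "walk (fst e) (rev (map inv_edge ?s) @ ?W) (fst e)" using loopW by auto
      then show "is_loop (rev (map inv_edge ?s) @ ?W)" using is_loop_iff_walk by metis
    qed
    have ext_p: "c (e # ?s @ e # ?W) (remove_plaquette K p) = 0" if K: "K p \<ge> 1"
      using IHP[of "remove_plaquette K p" "Suc j"] rem[OF K] n by simp
    have "?p \<noteq> ?q" using pq by (simp add: plaquette_inv_eq_iff)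
    have c: "c (e # ?W) K = - X + (if K ?p \<ge> 1 then c (?P j) (remove_plaquette K ?p) else 0)"
      unfolding master[OF loopW fin] neg pos_sum at ati sum_pair[OF pq(1)] sum_pair[OF \<open>?p \<noteq> ?q\<close>]
      using def_p ext_p True by simp
    show ?thesis
    proof (cases "j = 0")
      case True
      have "K ?p \<ge> 1 \<and> remove_plaquette K ?p = (\<lambda>_. 0) \<longleftrightarrow> K = single ?p"
        by (auto simp: remove_plaquette_def single_def fun_eq_iff)
      then show ?thesis using c True c_Nil[OF rem(1)] c_Nil[of "\<lambda>_. 0"] by (auto simp: X_def)
    next
      case False
      then show ?thesis using c by (simp add: X_def)
    qed
  qed
qed

lemma all_claims: "excess_claim n \<and> lipschitz_claim n \<and> power_claim n"
proof (induction n rule: less_induct)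
  case (less n)
  have E: "excess_claim n" using less by (rule excess_step)
  have L: "lipschitz_claim n" using lipschitz_step[OF _ E] less by blast
  have P: "power_claim n" using power_step[OF _ L] less by blast
  show ?case using E L P by blast
qed

lemma square_count_lipschitz:
  assumes "is_loop l" "finite_assignment K" "c l K \<noteq> 0" "neighbours e p q"
  shows "square_count K p \<le> square_count K q + undirected_count e l"
  using all_claims[of "5 * area K + length l"] assms unfolding lipschitz_claim_def by blast

end

section \<open>Adjacent squares\<close>

lemma uedge_inv [simp]: "uedge (inv_edge e) = uedge e"
  by (auto simp: uedge_def)

lemma uedge_eq_iff: "uedge e = uedge f \<longleftrightarrow> e = f \<or> e = inv_edge f"
  by (cases e; cases f) (auto simp: uedge_def doubleton_eq_iff)

text \<open>Unoriented edges, named by their lower or left end. As opaque constants they make the intersection of the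
  edge sets of two squares computable from injectivity alone.\<close>

definition vertical :: "int \<Rightarrow> int \<Rightarrow> vertex set" where "vertical x y = {(x, y), (x, y + 1)}"

definition horizontal :: "int \<Rightarrow> int \<Rightarrow> vertex set" where "horizontal x y = {(x, y), (x + 1, y)}"

lemma vertical_horizontal_simps [simp]:
  "vertical x y = vertical x' y' \<longleftrightarrow> x = x' \<and> y = y'"
  "horizontal x y = horizontal x' y' \<longleftrightarrow> x = x' \<and> y = y'"
  "vertical x y \<noteq> horizontal x' y'" "horizontal x' y' \<noteq> vertical x y"
  by (auto simp: vertical_def horizontal_def doubleton_eq_iff)

lemma uedges_of_square:
  "uedge ` set (plaquette_loop (Plaquette (x, y) s)) = {vertical x y, vertical (x + 1) y, horizontal x y, horizontal x (y + 1)}"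
  by (cases s) (auto simp: plaquette_loop_pos plaquette_loop_neg uedge_def vertical_def horizontal_def)

lemma adjacent_cases:
  assumes "adjacent p q" "positive p" "positive q"
  obtains x y where "p = square_at x y" "q = square_at (x + 1) y"
  | x y where "p = square_at (x + 1) y" "q = square_at x y"
  | x y where "p = square_at x y" "q = square_at x (y + 1)"
  | x y where "p = square_at x (y + 1)" "q = square_at x y"
proof -
  obtain x y where p: "p = square_at x y" using assms(2) by (metis plaquette.collapse surj_pair)
  obtain a b where q: "q = square_at a b" using assms(3) by (metis plaquette.collapse surj_pair)
  let ?U = "\<lambda>x y. {vertical x y, vertical (x + 1) y, horizontal x y, horizontal x (y + 1)}"
  have card: "card (?U x y \<inter> ?U a b) = 1"
    using assms(1) unfolding adjacent_def p q uedges_of_square .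
  have "(x, y) \<noteq> (a, b)"
  proof
    assume "(x, y) = (a, b)"
    then have "card (?U x y) = 1" using card by simp
    then show False by simp
  qed
  moreover have "?U x y \<inter> ?U a b \<noteq> {}" using card by (metis card.empty zero_neq_one)
  ultimately have "b = y \<and> a = x + 1 \<or> b = y \<and> x = a + 1 \<or> a = x \<and> b = y + 1 \<or> a = x \<and> y = b + 1"
    by auto
  then show ?thesis using that p q by blast
qed

lemma common_uedge:
  "uedge ` set (plaquette_loop (square_at x y)) \<inter> uedge ` set (plaquette_loop (square_at (x + 1) y)) = {vertical (x + 1) y}"
  "uedge ` set (plaquette_loop (square_at x y)) \<inter> uedge ` set (plaquette_loop (square_at x (y + 1))) = {horizontal x (y + 1)}"
  unfolding uedges_of_square by auto

lemma shared_edge_squares: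
  "shared_edge (square_at x y) (square_at (x + 1) y) = vertical (x + 1) y"
  "shared_edge (square_at (x + 1) y) (square_at x y) = vertical (x + 1) y"
  "shared_edge (square_at x y) (square_at x (y + 1)) = horizontal x (y + 1)"
  "shared_edge (square_at x (y + 1)) (square_at x y) = horizontal x (y + 1)"
  unfolding shared_edge_def common_uedge
    Int_commute[of "uedge ` set (plaquette_loop (square_at (x + 1) y))"]
    Int_commute[of "uedge ` set (plaquette_loop (square_at x (y + 1)))"] by simp_all

lemma adjacent_squares:
  "adjacent (square_at x y) (square_at (x + 1) y)" "adjacent (square_at (x + 1) y) (square_at x y)"
  unfolding adjacent_def common_uedge
    Int_commute[of "uedge ` set (plaquette_loop (square_at (x + 1) y))"] by simp_all

lemma crossing_sign_inv: "crossing_sign p q (inv_edge e) = - crossing_sign p q e"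
proof -
  define d where "d e = (fst (corner q) - fst (corner p)) * (snd (snd e) - snd (fst e)) -
      (snd (corner q) - snd (corner p)) * (fst (snd e) - fst (fst e))" for e :: edge
  have "d (inv_edge e) = - d e" by (simp add: d_def algebra_simps)
  then show ?thesis unfolding crossing_sign_def d_def[symmetric] by (simp add: sgn_if)
qed

text \<open>Seen from \<open>p\<close>, the common edge in the orientation of \<open>p\<close> crosses towards \<open>q\<close> from left to right, since positive
  plaquettes are clockwise.\<close>

lemma adjacent_edge:
  assumes "adjacent p q" "positive p" "positive q"
  obtains e where "neighbours e p (plaquette_inv q)" "uedge e = shared_edge p q" "crossing_sign p q e = -1"
  using assms
proof (cases rule: adjacent_cases)
  case (1 x y)
  show ?thesis
  proof (rule that[of "inv_edge ((x + 1, y), (x + 1, y + 1))"])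
    show "neighbours (inv_edge ((x + 1, y), (x + 1, y + 1))) p (plaquette_inv q)"
      using neighbours_inv[OF neighbours_shifted(1)[of x y]] 1 by simp
  qed (simp_all add: 1 shared_edge_squares crossing_sign_def uedge_def vertical_def insert_commute)
next
  case (2 x y)
  show ?thesis
  proof (rule that[of "((x + 1, y), (x + 1, y + 1))"])
    show "neighbours ((x + 1, y), (x + 1, y + 1)) p (plaquette_inv q)"
      using neighbours_commute[OF neighbours_shifted(1)[of x y]] 2 by simp
  qed (simp_all add: 2 shared_edge_squares crossing_sign_def uedge_def vertical_def)
next
  case (3 x y)
  show ?thesis
  proof (rule that[of "((x, y + 1), (x + 1, y + 1))"])
    show "neighbours ((x, y + 1), (x + 1, y + 1)) p (plaquette_inv q)"
      using neighbours_shifted(2)[of x y] 3 by simp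
  qed (simp_all add: 3 shared_edge_squares crossing_sign_def uedge_def horizontal_def)
next
  case (4 x y)
  show ?thesis
  proof (rule that[of "inv_edge ((x, y + 1), (x + 1, y + 1))"])
    show "neighbours (inv_edge ((x, y + 1), (x + 1, y + 1))) p (plaquette_inv q)"
      using neighbours_inv[OF neighbours_commute[OF neighbours_shifted(2)[of x y]]] 4 by simp
  qed (simp_all add: 4 shared_edge_squares crossing_sign_def uedge_def horizontal_def insert_commute)
qed

lemma uedge_count_eq: "lattice_edge e \<Longrightarrow> uedge_count (uedge e) l = undirected_count e l"
  unfolding uedge_count_def by (induction l) (auto simp: undirected_count_Cons uedge_eq_iff)

lemma crossings_eq_count:
  assumes "uedge e = shared_edge p q" "crossing_sign p q e = -1" "lattice_edge e"
  shows "crossings_left_to_right l p q = count_list l e" "crossings_right_to_left l p q = count_list l (inv_edge e)"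
proof -
  note ne = inv_edge_neq[OF assms(3)]
  have s: "crossing_sign p q (inv_edge e) = 1" using assms(2) by (simp add: crossing_sign_inv)
  show "crossings_left_to_right l p q = count_list l e"
    unfolding crossings_left_to_right_def assms(1)[symmetric]
    using assms(2) s ne by (induction l) (auto simp: uedge_eq_iff)
  show "crossings_right_to_left l p q = count_list l (inv_edge e)"
    unfolding crossings_right_to_left_def assms(1)[symmetric]
    using assms(2) s ne by (induction l) (auto simp: uedge_eq_iff)
qed

lemma positive_squares:
  assumes "positive p"
  shows "Plaquette (corner p) True = p" "Plaquette (corner p) False = plaquette_inv p"
  using assms by (cases p; simp)+

section \<open>The height\<close>

lemma vertex_of_square_iff:
  "(\<exists>e\<in>set (plaquette_loop (Plaquette (x, y) s)). v \<in> uedge e) \<longleftrightarrow>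
    v \<in> {(x, y), (x, y + 1), (x + 1, y), (x + 1, y + 1)}"
  by (cases s) (auto simp: plaquette_loop_pos plaquette_loop_neg uedge_def)

lemma finite_vertices_in_box:
  assumes "finite V"
  shows "\<exists>B. \<forall>v\<in>V. in_lattice_box B v"
proof (intro exI ballI)
  fix v assume "v \<in> V"
  then have "\<bar>fst v\<bar> + \<bar>snd v\<bar> \<le> (\<Sum>v\<in>V. \<bar>fst v\<bar> + \<bar>snd v\<bar>)"
    using assms by (intro member_le_sum) auto
  then show "in_lattice_box (\<Sum>v\<in>V. \<bar>fst v\<bar> + \<bar>snd v\<bar>) v"
    unfolding in_lattice_box_def by (intro conjI; linarith)
qed

text \<open>The difference of two heights is the same at adjacent squares, and zero far to the right.\<close>

lemma is_height_unique:
  assumes "is_height l h" "is_height l h'"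
  shows "h = h'"
proof
  have pos: "h (square_at x y) = h' (square_at x y)" for x y
  proof -
    obtain B where B: "\<And>p. \<not> (\<forall>e\<in>set (plaquette_loop p). \<forall>v\<in>uedge e. in_lattice_box B v) \<Longrightarrow> h p = 0"
      using assms(1) unfolding is_height_def by blast
    obtain B' where B': "\<And>p. \<not> (\<forall>e\<in>set (plaquette_loop p). \<forall>v\<in>uedge e. in_lattice_box B' v) \<Longrightarrow> h' p = 0"
      using assms(2) unfolding is_height_def by blast
    have step: "h (square_at (x + int i) y) - h' (square_at (x + int i) y) = h (square_at x y) - h' (square_at x y)" for i
    proof (induction i)
      case (Suc i)
      have "adjacent (square_at (x + int i) y) (square_at (x + int i + 1) y)" by (rule adjacent_squares)
      then have "h (square_at (x + int i + 1) y) - h' (square_at (x + int i + 1) y) = h (square_at (x + int i) y) - h' (square_at (x + int i) y)"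
        using assms unfolding is_height_def by (smt (verit) plaquette.sel(2))
      then show ?case using Suc by (simp add: ac_simps)
    qed simp
    \<comment> \<open>a number of steps to the right that leaves both boxes\<close>
    let ?i = "nat (\<bar>x\<bar> + \<bar>B\<bar> + \<bar>B'\<bar> + 1)"
    have far: "\<not> (\<forall>e\<in>set (plaquette_loop (square_at (x + int ?i) y)). \<forall>v\<in>uedge e. in_lattice_box C v)"
      if "C = B \<or> C = B'" for C
    proof -
      have "((x + int ?i, y), (x + int ?i, y + 1)) \<in> set (plaquette_loop (square_at (x + int ?i) y))"
        by (simp add: plaquette_loop_pos)
      moreover have "(x + int ?i, y) \<in> uedge ((x + int ?i, y), (x + int ?i, y + 1))" by (simp add: uedge_def)
      moreover have "\<not> in_lattice_box C (x + int ?i, y)" using that by (auto simp: in_lattice_box_def)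
      ultimately show ?thesis by blast
    qed
    have "h (square_at (x + int ?i) y) = 0" "h' (square_at (x + int ?i) y) = 0"
      using B[OF far] B'[OF far] by blast+
    then show ?thesis using step[of ?i] by simp
  qed
  fix p
  obtain x y s where p: "p = Plaquette (x, y) s" by (metis plaquette.exhaust surj_pair)
  have "h (plaquette_inv (square_at x y)) = h' (plaquette_inv (square_at x y))"
    using assms pos unfolding is_height_def by metis
  then show "h p = h' p" using pos p by (cases s) auto
qed

text \<open>The height of a loop that \<open>K\<close> balances.\<close>

definition assignment_height :: "assignment \<Rightarrow> plaquette \<Rightarrow> int" where
  "assignment_height K p = int (K (Plaquette (corner p) False)) - int (K (Plaquette (corner p) True))"

context surface_sum
begin

lemma is_height_assignment_height:
  assumes "is_loop l" "finite_assignment K" "c l K \<noteq> 0"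
  shows "is_height l (assignment_height K)"
  unfolding is_height_def
proof (intro conjI allI impI)
  fix p show "assignment_height K (plaquette_inv p) = assignment_height K p"
    by (simp add: assignment_height_def)
next
  let ?V = "(\<Union>e\<in>set l. uedge e) \<union> (\<Union>p\<in>{p. K p \<noteq> 0}. \<Union>e\<in>set (plaquette_loop p). uedge e)"
  have "finite ?V" using assms(2) by (auto simp: finite_assignment_def uedge_def)
  from finite_vertices_in_box[OF this] obtain B where "\<forall>v\<in>?V. in_lattice_box B v" ..
  then have B: "in_lattice_box B v" if "v \<in> ?V" for v using that by (rule bspec)
  have "assignment_height K p = 0"
    if out: "\<not> (\<forall>e\<in>set (plaquette_loop p). \<forall>v\<in>uedge e. in_lattice_box B v)" for p
  proof -
    obtain x y s where p: "p = Plaquette (x, y) s" by (metis plaquette.exhaust surj_pair)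
    from out obtain v where "\<exists>e\<in>set (plaquette_loop p). v \<in> uedge e" and v: "\<not> in_lattice_box B v" by blast
    then have "v \<in> {(x, y), (x, y + 1), (x + 1, y), (x + 1, y + 1)}"
      by (simp only: p vertex_of_square_iff)
    then have "\<exists>e\<in>set (plaquette_loop (Plaquette (x, y) t)). v \<in> uedge e" for t
      by (simp only: vertex_of_square_iff)
    then have "v \<in> ?V" if "K (Plaquette (x, y) t) \<noteq> 0" for t
      using that by (intro UnI2 UN_I[of "Plaquette (x, y) t"]) simp_all
    then have "K (Plaquette (x, y) t) = 0" for t using B v by metis
    then show ?thesis by (simp add: assignment_height_def p)
  qed
  then show "\<exists>B. (\<forall>e\<in>set l. \<forall>v\<in>uedge e. in_lattice_box B v) \<and>
      (\<forall>p. \<not> (\<forall>e\<in>set (plaquette_loop p). \<forall>v\<in>uedge e. in_lattice_box B v) \<longrightarrow> assignment_height K p = 0)"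
    using B by blast
next
  fix p q assume pq: "positive p" "positive q" "adjacent p q"
  obtain e where e: "neighbours e p (plaquette_inv q)" "uedge e = shared_edge p q" "crossing_sign p q e = -1"
    using adjacent_edge[OF pq(3,1,2)] .
  have le: "lattice_edge e" using e(1) by (simp add: neighbours_def)
  have P: "Plaquette (corner r) True = r" "Plaquette (corner r) False = plaquette_inv r" if "positive r" for r
    using that by (cases r; simp)+
  show "assignment_height K q = assignment_height K p + int (crossings_right_to_left l p q) - int (crossings_left_to_right l p q)"
    using balanced_neighbours[OF balanced_if_nonzero[OF assms] e(1)]
    unfolding crossings_eq_count[OF e(2,3) le] assignment_height_def P[OF pq(1)] P[OF pq(2)] by simp
qed

lemma height_eq:
  assumes "is_loop l" "finite_assignment K" "c l K \<noteq> 0"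
  shows "height l = assignment_height K"
  unfolding height_def
  using is_height_assignment_height[OF assms] is_height_unique by (intro the_equality) auto

end

section \<open>The distance\<close>

text \<open>A path of distinct squares visits the squares along \<open>l\<close> only finitely often.\<close>

lemma summable_path_crossings:
  assumes "is_loop l" "infinite_plaquette_path P"
  shows "summable (\<lambda>i. uedge_count (shared_edge (P i) (P (Suc i))) l)"
proof (rule summable_finite)
  let ?A = "\<Union>f\<in>set l. plaquettes_at f \<union> plaquettes_at (inv_edge f)"
  have P: "inj P" "\<And>i. positive (P i)" "\<And>i. adjacent (P i) (P (Suc i))"
    using assms(2) by (auto simp: infinite_plaquette_path_def)
  have "lattice_edge f" if "f \<in> set l" for f using assms(1) that by (simp add: is_loop_def)
  then have "finite ?A"
    by (intro finite_UN_I finite_UnI finite_set finite_plaquettes_at) (simp_all only: lattice_edge_inv)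
  then show "finite (P -` ?A)" using P(1) by (rule finite_vimageI)
  fix i assume i: "i \<notin> P -` ?A"
  obtain e where e: "neighbours e (P i) (plaquette_inv (P (Suc i)))" "uedge e = shared_edge (P i) (P (Suc i))"
    using adjacent_edge[OF P(3)[of i] P(2) P(2)] .
  have le: "lattice_edge e" and pe: "P i \<in> plaquettes_at e" using e(1) by (auto simp: neighbours_def)
  have "e \<notin> set l" "inv_edge e \<notin> set l"
    using i pe by auto
  then show "uedge_count (shared_edge (P i) (P (Suc i))) l = 0"
    using uedge_count_eq[OF le, of l] e(2) by (simp add: undirected_count_eq_0)
qed

lemma ray_is_path:
  "infinite_plaquette_path (\<lambda>i. square_at (x + int i) y)"
  "infinite_plaquette_path (\<lambda>i. square_at (x - int i) y)"
  unfolding infinite_plaquette_path_def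
  using adjacent_squares(1)[of "x + int _" y] adjacent_squares(2)[of "x - int _ - 1" y]
  by (auto simp: inj_def algebra_simps)

lemma distance_attained:
  obtains P where "infinite_plaquette_path P" "P 0 = Plaquette (corner p) True" "path_crossings l P = distance l p"
proof -
  obtain x y where v: "corner p = (x, y)" by (metis surj_pair)
  have "\<exists>k P. infinite_plaquette_path P \<and> P 0 = Plaquette (corner p) True \<and> path_crossings l P = k"
    using ray_is_path(1)[of x y] by (intro exI[of _ "path_crossings l (\<lambda>i. square_at (x + int i) y)"] exI[of _ "\<lambda>i. square_at (x + int i) y"]) (simp add: v)
  from LeastI_ex[OF this] show ?thesis using that unfolding distance_def by blast
qed

context surface_sum
begin

lemma square_count_adjacent:
  assumes "is_loop l" "finite_assignment K" "c l K \<noteq> 0" "adjacent p q" "positive p" "positive q"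
  shows "square_count K p \<le> square_count K q + uedge_count (shared_edge p q) l"
proof -
  obtain e where e: "neighbours e p (plaquette_inv q)" "uedge e = shared_edge p q"
    using adjacent_edge[OF assms(4-6)] .
  have le: "lattice_edge e" using e(1) by (simp add: neighbours_def)
  show ?thesis using square_count_lipschitz[OF assms(1-3) e(1)] uedge_count_eq[OF le, of l] e(2) by simp
qed

text \<open>Telescope the Lipschitz bound along the path until it has left the support of \<open>K\<close>.\<close>

lemma square_count_le_path_crossings:
  assumes "is_loop l" "finite_assignment K" "c l K \<noteq> 0" "infinite_plaquette_path P"
  shows "square_count K (P 0) \<le> path_crossings l P"
proof -
  have P: "inj P" "\<And>i. positive (P i)" "\<And>i. adjacent (P i) (P (Suc i))"
    using assms(4) by (auto simp: infinite_plaquette_path_def)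
  let ?f = "\<lambda>i. uedge_count (shared_edge (P i) (P (Suc i))) l"
  obtain n where n: "square_count K (P n) = 0" using square_count_escapes[OF assms(2) P(1)] .
  have "square_count K (P 0) \<le> square_count K (P m) + sum ?f {..<m}" for m
  proof (induction m)
    case (Suc m)
    then show ?case using square_count_adjacent[OF assms(1-3) P(3)[of m] P(2) P(2)] by simp
  qed simp
  from this[of n] have "square_count K (P 0) \<le> sum ?f {..<n}" using n by simp
  also have "\<dots> \<le> path_crossings l P"
    unfolding path_crossings_def by (intro sum_le_suminf summable_path_crossings assms(1,4)) auto
  finally show ?thesis .
qed

lemma square_count_le_distance:
  assumes "is_loop l" "finite_assignment K" "c l K \<noteq> 0"
  shows "square_count K p \<le> distance l p"
proof -
  obtain P where P: "infinite_plaquette_path P" "P 0 = Plaquette (corner p) True" "path_crossings l P = distance l p"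
    using distance_attained .
  have "square_count K p = square_count K (P 0)"
    using P(2) square_count_False[of K "corner p"] by (cases p; cases "positive p") auto
  then show ?thesis using square_count_le_path_crossings[OF assms P(1)] P(3) by simp
qed

end

section \<open>The regions\<close>

text \<open>One coordinate of the fact that points near \<open>z\<close> lie in unit squares whose closure contains \<open>z\<close>.\<close>

lemma eventually_floor:
  fixes u :: real
  shows "\<forall>\<^sub>F u' in nhds u. \<lfloor>u'\<rfloor> = \<lfloor>u\<rfloor> \<or> u = of_int \<lfloor>u\<rfloor> \<and> \<lfloor>u'\<rfloor> = \<lfloor>u\<rfloor> - 1"
proof -
  let ?S = "if u = of_int \<lfloor>u\<rfloor> then {of_int \<lfloor>u\<rfloor> - 1<..<of_int \<lfloor>u\<rfloor> + 1} else {of_int \<lfloor>u\<rfloor><..<of_int \<lfloor>u\<rfloor> + 1 :: real}"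
  have "open ?S" by simp
  moreover have "u \<in> ?S" by (auto simp: less_le) linarith+
  ultimately have "\<forall>\<^sub>F u' in nhds u. u' \<in> ?S" by (rule eventually_nhds_in_open)
  then show ?thesis
  proof (rule eventually_mono)
    fix u' assume u': "u' \<in> ?S"
    show "\<lfloor>u'\<rfloor> = \<lfloor>u\<rfloor> \<or> u = of_int \<lfloor>u\<rfloor> \<and> \<lfloor>u'\<rfloor> = \<lfloor>u\<rfloor> - 1"
    proof (cases "u = of_int \<lfloor>u\<rfloor>")
      case True
      then have "of_int \<lfloor>u\<rfloor> - 1 < u'" "u' < of_int \<lfloor>u\<rfloor> + 1" using u' by auto
      then show ?thesis using True by linarith
    next
      case False
      then have "of_int \<lfloor>u\<rfloor> < u'" "u' < of_int \<lfloor>u\<rfloor> + 1" using u' by auto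
      then show ?thesis by linarith
    qed
  qed
qed

lemma point_on_edge:
  "of_int y \<le> v \<Longrightarrow> v \<le> of_int y + 1 \<Longrightarrow>
    (of_int x, v) \<in> closed_segment (plane_point (x, y)) (plane_point (x, y + 1))"
  "of_int x \<le> u \<Longrightarrow> u \<le> of_int x + 1 \<Longrightarrow>
    (u, of_int y) \<in> closed_segment (plane_point (x, y)) (plane_point (x + 1, y))"
  unfolding closed_segment_def plane_point_def
  by (auto intro: exI[of _ "v - of_int y"] exI[of _ "u - of_int x"] simp: algebra_simps)

lemma not_on_trace:
  assumes "z \<notin> loop_trace l" "z \<in> closed_segment (plane_point a) (plane_point b)"
  shows "(a, b) \<notin> set l" "(b, a) \<notin> set l"
  using assms unfolding loop_trace_def by (force simp: closed_segment_commute)+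

context surface_sum
begin

lemma equal_across_free_edge:
  assumes "is_loop l" "finite_assignment K" "c l K \<noteq> 0" "neighbours e p q" "e \<notin> set l" "inv_edge e \<notin> set l"
  shows "K p = K (plaquette_inv q)" "K (plaquette_inv p) = K q"
proof -
  have u: "undirected_count e l = 0" using assms(5,6) by (simp add: undirected_count_eq_0)
  have "square_count K p = square_count K q"
    using square_count_lipschitz[OF assms(1-4)] square_count_lipschitz[OF assms(1-3) neighbours_commute[OF assms(4)]] u by simp
  moreover have "K p + K q = K (plaquette_inv p) + K (plaquette_inv q)"
    using balanced_neighbours[OF balanced_if_nonzero[OF assms(1-3)] assms(4)] assms(5,6) by (simp add: count_list_0_iff)
  ultimately show "K p = K (plaquette_inv q)" "K (plaquette_inv p) = K q"
    by (simp_all add: square_count_def)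
qed

text \<open>The value of \<open>K\<close> at the unit square of a point is locally constant off the loop: a point close to \<open>z\<close> lies in a
  square that is reached from the square of \<open>z\<close> across at most two edges through \<open>z\<close>, and these edges
  are not in the loop.\<close>

lemma equal_in_region:
  assumes l: "is_loop l" "finite_assignment K" "c l K \<noteq> 0" and reg: "same_region l p q"
  shows "K (Plaquette (corner p) s) = K (Plaquette (corner q) s)"
proof -
  obtain C where C: "C \<in> components (- loop_trace l)" and sub: "unit_square p \<subseteq> C" "unit_square q \<subseteq> C"
    using reg unfolding same_region_def by blast
  define G where "G z = K (Plaquette (\<lfloor>fst z\<rfloor>, \<lfloor>snd z\<rfloor>) s)" for z :: "real \<times> real"
  have vert: "K (Plaquette (x - 1, y) s) = K (Plaquette (x, y) s)"
    if "((x, y), (x, y + 1)) \<notin> set l" "((x, y + 1), (x, y)) \<notin> set l" for x y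
    using equal_across_free_edge[OF l neighbours_simps(1)[of x y]] that by (cases s) simp_all
  have hor: "K (Plaquette (x, y - 1) s) = K (Plaquette (x, y) s)"
    if "((x, y), (x + 1, y)) \<notin> set l" "((x + 1, y), (x, y)) \<notin> set l" for x y
    using equal_across_free_edge[OF l neighbours_simps(2)[of x y]] that by (cases s) simp_all
  have local: "\<forall>\<^sub>F z' in at z within C. G z = G z'" if z: "z \<in> C" for z
  proof -
    obtain u v where uv: "z = (u, v)" by (metis surj_pair)
    have zt: "(u, v) \<notin> loop_trace l" using z C in_components_subset uv by blast
    let ?a = "\<lfloor>u\<rfloor>" and ?b = "\<lfloor>v\<rfloor>"
    have "(fst \<longlongrightarrow> u) (at z within C)" "(snd \<longlongrightarrow> v) (at z within C)"
      using tendsto_fst[OF tendsto_ident_at, of z C] tendsto_snd[OF tendsto_ident_at, of z C] by (simp_all add: uv)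
    then have
      "\<forall>\<^sub>F z' in at z within C. \<lfloor>fst z'\<rfloor> = ?a \<or> u = of_int ?a \<and> \<lfloor>fst z'\<rfloor> = ?a - 1"
      "\<forall>\<^sub>F z' in at z within C. \<lfloor>snd z'\<rfloor> = ?b \<or> v = of_int ?b \<and> \<lfloor>snd z'\<rfloor> = ?b - 1"
      using eventually_floor by (auto dest: eventually_compose_filterlim[rotated])
    then show ?thesis
    proof eventually_elim
      case (elim z')
      have ab: "of_int ?a \<le> u" "u \<le> of_int ?a + 1" "of_int ?b \<le> v" "v \<le> of_int ?b + 1" by linarith+
      have v1: "K (Plaquette (?a - 1, ?b) s) = K (Plaquette (?a, ?b) s)" if "u = of_int ?a"
      proof (rule vert)
        have "(u, v) \<in> closed_segment (plane_point (?a, ?b)) (plane_point (?a, ?b + 1))"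
          using point_on_edge(1)[OF ab(3,4), of ?a] that by simp
        from not_on_trace[OF zt this]
        show "((?a, ?b), (?a, ?b + 1)) \<notin> set l" "((?a, ?b + 1), (?a, ?b)) \<notin> set l" .
      qed
      have h1: "K (Plaquette (?a, ?b - 1) s) = K (Plaquette (?a, ?b) s)" if "v = of_int ?b"
      proof (rule hor)
        have "(u, v) \<in> closed_segment (plane_point (?a, ?b)) (plane_point (?a + 1, ?b))"
          using point_on_edge(2)[OF ab(1,2), of ?b] that by simp
        from not_on_trace[OF zt this]
        show "((?a, ?b), (?a + 1, ?b)) \<notin> set l" "((?a + 1, ?b), (?a, ?b)) \<notin> set l" .
      qed
      have h2: "K (Plaquette (?a - 1, ?b - 1) s) = K (Plaquette (?a - 1, ?b) s)" if "u = of_int ?a" "v = of_int ?b"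
      proof (rule hor)
        have "(u, of_int ?b) \<in> closed_segment (plane_point (?a - 1, ?b)) (plane_point (?a - 1 + 1, ?b))"
          using that(1) by (intro point_on_edge(2)) simp_all
        then have "(u, v) \<in> closed_segment (plane_point (?a - 1, ?b)) (plane_point (?a - 1 + 1, ?b))"
          using that(2) by simp
        from not_on_trace[OF zt this]
        show "((?a - 1, ?b), (?a - 1 + 1, ?b)) \<notin> set l" "((?a - 1 + 1, ?b), (?a - 1, ?b)) \<notin> set l" .
      qed
      show ?case using elim v1 h1 h2 unfolding G_def uv by auto
    qed
  qed
  have mid: "\<exists>z\<in>C. G z = K (Plaquette (corner r) s)" if "unit_square r \<subseteq> C" for r
  proof -
    obtain x y where xy: "corner r = (x, y)" by (metis surj_pair)
    let ?z = "(of_int x + 1 / 2, of_int y + 1 / 2) :: real \<times> real"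
    have "?z \<in> unit_square r"
      unfolding unit_square_def box_prod by (simp add: xy plane_point_def)
    moreover have "\<lfloor>of_int x + 1 / 2 :: real\<rfloor> = x" "\<lfloor>of_int y + 1 / 2 :: real\<rfloor> = y" by linarith+
    ultimately show ?thesis using that xy by (intro bexI[of _ ?z]) (auto simp: G_def)
  qed
  obtain z z' where z: "z \<in> C" "G z = K (Plaquette (corner p) s)" "z' \<in> C" "G z' = K (Plaquette (corner q) s)"
    using mid[OF sub(1)] mid[OF sub(2)] by blast
  have "G z = G z'"
    using in_components_connected[OF C] z(1,3) local by (intro connected_local_const) auto
  then show ?thesis using z by simp
qed

section \<open>Canonical assignments\<close>

lemma mem_canonical_reduced:
  assumes l: "is_loop l" "finite_assignment K" "c l K \<noteq> 0"
  shows "K \<in> canonical_reduced l"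
proof -
  \<comment> \<open>the part of \<open>K\<close> that is common to both orientations\<close>
  define K' where "K' p = min (K p) (K (plaquette_inv p))" for p
  have h: "height l p = int (K (Plaquette (corner p) False)) - int (K (Plaquette (corner p) True))" for p
    by (simp add: height_eq[OF l] assignment_height_def)
  have hp: "height l p = int (K (plaquette_inv p)) - int (K p)" if "positive p" for p
    using h[of p] positive_squares[OF that] by simp
  have hn: "height l p = int (K p) - int (K (plaquette_inv p))" if "\<not> positive p" for p
    using h[of p] that by (cases p) simp
  have "K p = height_assignment l p + K' p" for p
    unfolding height_assignment_def K'_def using hp[of p] hn[of p] by auto
  moreover have "K' p = K' (plaquette_inv p)" for p by (simp add: K'_def min.commute)
  moreover have "K' p = K' q" if "positive p" "positive q" "same_region l p q" for p q
    using equal_in_region[OF l that(3), of True] equal_in_region[OF l that(3), of False]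
    unfolding K'_def positive_squares[OF that(1)] positive_squares[OF that(2)] by simp
  moreover have "real (K' p) \<le> (real (distance l p) - real_of_int \<bar>height l p\<bar>) / 2" if "positive p" for p
  proof -
    have "2 * int (K' p) + \<bar>height l p\<bar> = int (square_count K p)"
      unfolding hp[OF that] K'_def square_count_def by (auto simp: min_def)
    also have "\<dots> \<le> int (distance l p)" using square_count_le_distance[OF l, of p] by simp
    finally have "real_of_int (2 * int (K' p) + \<bar>height l p\<bar>) \<le> real_of_int (int (distance l p))"
      by (simp only: of_int_le_iff)
    then show ?thesis by simp
  qed
  ultimately show ?thesis unfolding canonical_reduced_def using l(2) by blast
qed

text \<open>By the Lipschitz bound \<open>K p\<close> is at most the distance of \<open>p\<close>, and zero for squares outside a box around the loop,
  from which a horizontal ray escapes without crossing it.\<close>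

lemma finite_support:
  assumes l: "is_loop l"
  shows "finite {K. finite_assignment K \<and> c l K \<noteq> 0}"
proof -
  obtain B where B: "\<forall>v\<in>\<Union>e\<in>set l. uedge e. in_lattice_box B v"
    using finite_vertices_in_box[of "\<Union>e\<in>set l. uedge e"] by (auto simp: uedge_def)
  have out: "uedge_count (vertical x y) l = 0" if "\<bar>x\<bar> > B \<or> \<bar>y\<bar> > B" for x y
  proof -
    have "uedge e \<noteq> vertical x y" if "e \<in> set l" for e
    proof
      assume "uedge e = vertical x y"
      then have "(x, y) \<in> uedge e" by (simp add: vertical_def)
      then have "in_lattice_box B (x, y)" using B that by blast
      then show False using \<open>\<bar>x\<bar> > B \<or> \<bar>y\<bar> > B\<close> by (auto simp: in_lattice_box_def)
    qed
    then show ?thesis by (simp add: uedge_count_def filter_empty_conv)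
  qed
  define box where "box = (\<lambda>(v, s). Plaquette v s) ` (({-B..B} \<times> {-B..B}) \<times> (UNIV :: bool set))"
  have fbox: "finite box" unfolding box_def by (intro finite_imageI finite_cartesian_product) auto
  have zero: "square_count K (Plaquette (x, y) s) = 0"
    if K: "finite_assignment K" "c l K \<noteq> 0" and xy: "Plaquette (x, y) s \<notin> box" for K x y s
  proof -
    have "\<bar>x\<bar> > B \<or> \<bar>y\<bar> > B" using xy unfolding box_def by (force simp: image_iff)
    then consider "x > B \<or> \<bar>y\<bar> > B" | "x < - B" by linarith
    then have "square_count K (square_at x y) = 0"
    proof cases
      case 1
      let ?P = "\<lambda>i. square_at (x + int i) y"
      have "shared_edge (?P i) (?P (Suc i)) = vertical (x + int i + 1) y" for i
        using shared_edge_squares(1)[of "x + int i" y] by (simp add: ac_simps)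
      moreover have "uedge_count (vertical (x + int i + 1) y) l = 0" for i using 1 by (intro out) auto
      ultimately have "path_crossings l ?P = 0" by (simp add: path_crossings_def)
      then show ?thesis using square_count_le_path_crossings[OF l K ray_is_path(1)[of x y]] by simp
    next
      case 2
      let ?P = "\<lambda>i. square_at (x - int i) y"
      have "shared_edge (?P i) (?P (Suc i)) = vertical (x - int i) y" for i
        using shared_edge_squares(2)[of "x - int i - 1" y] by (simp add: algebra_simps)
      moreover have "uedge_count (vertical (x - int i) y) l = 0" for i using 2 by (intro out) auto
      ultimately have "path_crossings l ?P = 0" by (simp add: path_crossings_def)
      then show ?thesis using square_count_le_path_crossings[OF l K ray_is_path(2)[of x y]] by simp
    qed
    then show ?thesis by (cases s) (simp_all add: square_count_False)
  qed
  let ?N = "Max (distance l ` box)"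
  have "{K. finite_assignment K \<and> c l K \<noteq> 0} \<subseteq> {K. \<forall>p. (p \<in> box \<longrightarrow> K p \<in> {..?N}) \<and> (p \<notin> box \<longrightarrow> K p = 0)}"
  proof (intro subsetI CollectI allI conjI impI)
    fix K p assume "K \<in> {K. finite_assignment K \<and> c l K \<noteq> 0}"
    then have K: "finite_assignment K" "c l K \<noteq> 0" by auto
    show "K p = 0" if "p \<notin> box"
      using zero[OF K, of "fst (corner p)" "snd (corner p)" "positive p"] that by (simp add: square_count_def)
    show "K p \<in> {..?N}" if "p \<in> box"
    proof -
      have "K p \<le> square_count K p" by (simp add: square_count_def)
      also have "\<dots> \<le> distance l p" by (rule square_count_le_distance[OF l K])
      also have "\<dots> \<le> ?N" using that fbox by simp
      finally show ?thesis by simp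
    qed
  qed
  moreover have "finite \<dots>" using fbox by (rule finite_set_of_finite_funs) simp
  ultimately show ?thesis by (rule finite_subset)
qed

end

theorem theorem1p13:
  fixes c :: "edge list \<Rightarrow> assignment \<Rightarrow> real" and l :: "edge list" and \<beta> :: real
  assumes "surface_coefficients c"
    and "is_loop l"
    and "\<not> trivial_loop l"
  shows "(\<forall>K. finite_assignment K \<longrightarrow> K \<notin> canonical_collection l \<longrightarrow> phi_term c \<beta> l K = 0) \<and>
    phi_term c \<beta> l summable_on {K. finite_assignment K} \<and>
    phi c \<beta> l = (\<Sum>\<^sub>\<infinity>K\<in>canonical_collection l. c l K * \<beta> ^ area K)"
proof -
  interpret surface_sum c by unfold_locales (rule assms(1))
  have zero: "c l K = 0" if K: "finite_assignment K" "K \<notin> canonical_collection l" for K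
  proof (cases "has_backtrack l")
    case True
    note r = c_remove_backtracks[OF assms(2)]
    have "c (remove_backtracks l) K = 0"
      using mem_canonical_reduced[of "remove_backtracks l" K] r K True by (auto simp: canonical_collection_def)
    then show ?thesis using r K(1) by simp
  next
    case False
    then show ?thesis using mem_canonical_reduced[OF assms(2) K(1)] K(2) by (auto simp: canonical_collection_def)
  qed
  have fin: "finite_assignment K" if "K \<in> canonical_collection l" for K
    using that by (auto simp: canonical_collection_def canonical_reduced_def split: if_splits)
  have "phi_term c \<beta> l summable_on {K. finite_assignment K} \<longleftrightarrow>
      phi_term c \<beta> l summable_on {K. finite_assignment K \<and> c l K \<noteq> 0}"
    by (rule summable_on_cong_neutral) (auto simp: phi_term_def)
  then have "phi_term c \<beta> l summable_on {K. finite_assignment K}"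
    using finite_support[OF assms(2)] by simp
  moreover have "phi c \<beta> l = (\<Sum>\<^sub>\<infinity>K\<in>canonical_collection l. c l K * \<beta> ^ area K)"
    unfolding phi_def by (rule infsum_cong_neutral) (use zero fin in \<open>auto simp: phi_term_def\<close>)
  ultimately show ?thesis using zero by (simp add: phi_term_def)
qed

end
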